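(* Let $T$ be a complete totally transcendental first-order theory with elimination of imaginaries, let $\mathcal U$ be a monster model of $T$, and let $A$ be a small $dcl$-closed set of parameters. (1) Let $H$ be an $A$-definable group, let $Q$ be an $A$-definable right torsor for $H$, and let $b\in Q(\mathcal U)$. Then $B=dcl(A,b)$ is a Galois extension of $A$ relative to $H$ if and only if $H(B)=H(A)$. (2) Let $B=dcl(A,b)$ be a Galois extension of $A$ relative to some $A$-definable set $X$. Let $Q$ be the set of realizations of $tp(b/A)$, and let $H$ be the $A$-definable group acting regularly on $Q$ given by the Torsor Theorem, so that $Q$ is an $A$-definable right torsor for $H$. Suppose that $H$ is a subgroup of an $A$-definable group $G$. Then: (a) there is an $A$-definable right torsor $W$ for $G$ such that $Q$ is $A$-definably isomorphic, as an $H$-torsor, to an orbit of $H$ on $W$, and $B$ is generated over $A$ (that is, $B=dcl(A,c)$) by some $(W,G,H)$-primitive $c$ over $A$; (b) the image of the class of $Q$ under the natural map $\iota^1:\operatorname{H}^1_{\operatorname{def}}(A,H)\to\operatorname{H}^1_{\operatorname{def}}(A,G)$ is trivial if and only if $Q$ is $A$-definably isomorphic (as an $H$-torsor) to an $A$-definable left coset $gH$ of $H$ in $G$; in that case $B$ is generated over $A$ by a $(G,H)$-primitive over $A$. This happens in particular when $\operatorname{H}^1_{\operatorname{def}}(A,G)$ is trivial.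
   Context: For an $A$-definable set $X$ and a complete type $q$ over $A$: $q$ is strongly internal to $X$ if for any two realizations $b_1,b_2$ of $q$ we have $b_2\in dcl(b_1,A,X(\mathcal U))$; $q$ is weakly orthogonal to $X$ if $q$ has a unique extension to a complete type over $A\cup X(\mathcal U)$ (equivalently, for a realization $b$, $X(dcl(A,b))=X(A)$). A $dcl$-closed set $B$ is a Galois extension of $A$ relative to $X$ if $B=dcl(A,b)$ for some tuple $b$ with $tp(b/A)$ strongly internal and weakly orthogonal to $X$. Torsor Theorem (known): if $tp(b/A)$ is strongly internal and weakly orthogonal to $X$ and $Q$ is its set of realizations, then the group of permutations of $Q$ that are elementary over $A\cup X(\mathcal U)$ is isomorphic to an $A$-definable group $H$ (living in $dcl(A,X)$) and $Q$ is an $A$-definable right torsor for $H$ (regular right action). For an $A$-definable group $G$, $\operatorname{H}^1_{\operatorname{def}}(A,G)$ denotes the pointed set of $A$-definable right torsors for $G$ modulo $A$-definable isomorphism of torsors (bijections commuting with the action); the trivial class is that of $G$ acting on itself by right multiplication (equivalently, of torsors having an $A$-point). For an $A$-definable subgroup $H\le G$, $\iota^1$ sends the class of an $A$-definable $H$-torsor $V$ to the class of the $G$-torsor $(V\times G)/\!\sim$, where $(v_1,g_1)\sim(v_2,g_2)$ iff there is $h\in H$ with $v_2=v_1h$ and $g_1=hg_2$, with $G$ acting by right multiplication on the second coordinate (this is $A$-definable by elimination of imaginaries). Primitives: let $H\le G$ be $A$-definable groups. An element $a\in G$ is a $(G,H)$-primitive over $A$ if its image under the $A$-definable quotient map $G\to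 G/H$ (left cosets) is an $A$-point. If $W$ is an $A$-definable right torsor for $G$, then $H$ acts on $W$; an element $a\in W$ is a $(W,G,H)$-primitive over $A$ if its image under the $A$-definable quotient map $W\to W/H$ (orbits of $H$) is an $A$-point. *)

theory Defs
  imports "HOL-Algebra.Coset" "HOL-Algebra.Bij"
begin

unbundle cardinal_syntax

section \<open>First-order logic\<close>

text \<open>
  A language is a set of function symbols and a set of relation symbols, each symbol coming with
  its arity (constants are function symbols of arity 0). Variables are de Bruijn indices:
  \<open>Ex \<phi>\<close> binds index 0 of \<open>\<phi>\<close> and shifts the other indices by one.
\<close>

datatype 'f trm = Var nat | Fn 'f "'f trm list"

datatype ('f, 'r) fm =
    Eq "'f trm" "'f trm"
  | Rel 'r "'f trm list"
  | Neg "('f, 'r) fm"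
  | Conj "('f, 'r) fm" "('f, 'r) fm"
  | Ex "('f, 'r) fm"

record ('f, 'r) lang =
  fsyms :: "('f \<times> nat) set"
  rsyms :: "('r \<times> nat) set"

text \<open>The universe of a structure is the whole type \<open>'a\<close>. The interpretations are only meaningful
  on argument lists whose length is an arity of the symbol.\<close>

record ('f, 'r, 'a) struct = "('f, 'r) lang" +
  fint :: "'f \<Rightarrow> 'a list \<Rightarrow> 'a"
  rint :: "'r \<Rightarrow> 'a list \<Rightarrow> bool"

primrec fvt :: "'f trm \<Rightarrow> nat set" where
  "fvt (Var i) = {i}"
| "fvt (Fn f ts) = \<Union> (set (map fvt ts))"

primrec fv :: "('f, 'r) fm \<Rightarrow> nat set" where
  "fv (Eq s t) = fvt s \<union> fvt t"
| "fv (Rel r ts) = \<Union> (set (map fvt ts))"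
| "fv (Neg \<phi>) = fv \<phi>"
| "fv (Conj \<phi> \<psi>) = fv \<phi> \<union> fv \<psi>"
| "fv (Ex \<phi>) = {i. Suc i \<in> fv \<phi>}"

primrec wft :: "('f, 'r, 'z) lang_scheme \<Rightarrow> 'f trm \<Rightarrow> bool" where
  "wft L (Var i) \<longleftrightarrow> True"
| "wft L (Fn f ts) \<longleftrightarrow> (f, length ts) \<in> fsyms L \<and> list_all id (map (wft L) ts)"

primrec wff :: "('f, 'r, 'z) lang_scheme \<Rightarrow> ('f, 'r) fm \<Rightarrow> bool" where
  "wff L (Eq s t) \<longleftrightarrow> wft L s \<and> wft L t"
| "wff L (Rel r ts) \<longleftrightarrow> (r, length ts) \<in> rsyms L \<and> list_all (wft L) ts"
| "wff L (Neg \<phi>) \<longleftrightarrow> wff L \<phi>"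
| "wff L (Conj \<phi> \<psi>) \<longleftrightarrow> wff L \<phi> \<and> wff L \<psi>"
| "wff L (Ex \<phi>) \<longleftrightarrow> wff L \<phi>"

primrec eval :: "('f, 'r, 'a) struct \<Rightarrow> (nat \<Rightarrow> 'a) \<Rightarrow> 'f trm \<Rightarrow> 'a" where
  "eval M e (Var i) = e i"
| "eval M e (Fn f ts) = fint M f (map (eval M e) ts)"

primrec sat :: "('f, 'r, 'a) struct \<Rightarrow> (nat \<Rightarrow> 'a) \<Rightarrow> ('f, 'r) fm \<Rightarrow> bool" where
  "sat M e (Eq s t) \<longleftrightarrow> eval M e s = eval M e t"
| "sat M e (Rel r ts) \<longleftrightarrow> rint M r (map (eval M e) ts)"
| "sat M e (Neg \<phi>) \<longleftrightarrow> \<not> sat M e \<phi>"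
| "sat M e (Conj \<phi> \<psi>) \<longleftrightarrow> sat M e \<phi> \<and> sat M e \<psi>"
| "sat M e (Ex \<phi>) \<longleftrightarrow> (\<exists>a. sat M (case_nat a e) \<phi>)"

definition formulas :: "('f, 'r, 'z) lang_scheme \<Rightarrow> nat \<Rightarrow> ('f, 'r) fm set" where
  "formulas L n = {\<phi>. wff L \<phi> \<and> fv \<phi> \<subseteq> {..<n}}"

text \<open>A theory is taken to be deductively closed; it is complete iff it decides every sentence.
  Consistency is expressed by \<open>models M T\<close>.\<close>

definition complete_theory :: "('f, 'r, 'z) lang_scheme \<Rightarrow> ('f, 'r) fm set \<Rightarrow> bool" where
  "complete_theory L T \<longleftrightarrow> T \<subseteq> formulas L 0 \<and> (\<forall>\<phi> \<in> formulas L 0. \<phi> \<in> T \<or> Neg \<phi> \<in> T)"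

definition models :: "('f, 'r, 'a) struct \<Rightarrow> ('f, 'r) fm set \<Rightarrow> bool" where
  "models M T \<longleftrightarrow> (\<forall>\<phi> \<in> T. \<forall>e. sat M e \<phi>)"


section \<open>Definable sets, definable closure, types\<close>

text \<open>Tuples are lists, and an \<open>n\<close>-tuple followed by an \<open>m\<close>-tuple is the list obtained by
  appending them. A formula with parameters is a pair of a formula and the list of parameters
  substituted for the last variables.\<close>

definition tuples :: "nat \<Rightarrow> 'a list set" where
  "tuples n = {xs. length xs = n}"

definition param_formulas ::
    "('f, 'r, 'a) struct \<Rightarrow> 'a set \<Rightarrow> nat \<Rightarrow> (('f, 'r) fm \<times> 'a list) set" where
  "param_formulas M A n = {(\<phi>, as). set as \<subseteq> A \<and> \<phi> \<in> formulas M (n + length as)}"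

definition holds :: "('f, 'r, 'a) struct \<Rightarrow> 'a list \<Rightarrow> ('f, 'r) fm \<times> 'a list \<Rightarrow> bool" where
  "holds M xs p \<longleftrightarrow> sat M ((!) (xs @ snd p)) (fst p)"

definition definable_set ::
    "('f, 'r, 'a) struct \<Rightarrow> 'a set \<Rightarrow> nat \<Rightarrow> 'a list set \<Rightarrow> bool" where
  "definable_set M A n X \<longleftrightarrow> (\<exists>p \<in> param_formulas M A n. X = {xs \<in> tuples n. holds M xs p})"

definition definable_map ::
    "('f, 'r, 'a) struct \<Rightarrow> 'a set \<Rightarrow> 'a list set \<Rightarrow> ('a list \<Rightarrow> 'a list) \<Rightarrow> bool" where
  "definable_map M A X f \<longleftrightarrow>
    (\<exists>n m. X \<subseteq> tuples n \<and> f ` X \<subseteq> tuples m \<and> definable_set M A (n + m) {x @ f x | x. x \<in> X})"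

definition dcl :: "('f, 'r, 'a) struct \<Rightarrow> 'a set \<Rightarrow> 'a set" where
  "dcl M A = {a. definable_set M A 1 {[a]}}"

text \<open>\<open>coords X\<close> is the set of elements occurring in the tuples of \<open>X\<close>; a set of the form
  \<open>A \<union> X(U)\<close> is \<open>A \<union> coords X\<close>. \<open>points X B\<close> is \<open>X(B)\<close>, for \<open>B\<close> definably closed.\<close>

definition coords :: "'a list set \<Rightarrow> 'a set" where
  "coords X = (\<Union>x \<in> X. set x)"

definition points :: "'a list set \<Rightarrow> 'a set \<Rightarrow> 'a list set" where
  "points X B = {x \<in> X. set x \<subseteq> B}"

definition tp :: "('f, 'r, 'a) struct \<Rightarrow> 'a set \<Rightarrow> 'a list \<Rightarrow> (('f, 'r) fm \<times> 'a list) set" where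
  "tp M A b = {p \<in> param_formulas M A (length b). holds M b p}"

definition realizations ::
    "('f, 'r, 'a) struct \<Rightarrow> nat \<Rightarrow> (('f, 'r) fm \<times> 'a list) set \<Rightarrow> 'a list set" where
  "realizations M n q = {b \<in> tuples n. \<forall>p \<in> q. holds M b p}"


section \<open>Totally transcendental theories, elimination of imaginaries, monster models\<close>

text \<open>
  \<open>has_morley_rank M D\<close> says that the Morley rank of \<open>D\<close> (computed in \<open>M\<close>, which will be
  saturated) is not \<open>\<infinity>\<close>. Indeed \<open>RM D \<ge> \<alpha> + 1\<close> iff \<open>D\<close> has infinitely many pairwise disjoint
  definable subsets of rank \<open>\<ge> \<alpha>\<close>, so that the least predicate below, whose stages are indexed by
  ordinals, collects the sets of ordinal rank together with the empty set.
\<close>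

inductive has_morley_rank :: "('f, 'r, 'a) struct \<Rightarrow> nat \<Rightarrow> 'a list set \<Rightarrow> bool"
  for M :: "('f, 'r, 'a) struct" and n :: nat where
  "(\<And>E :: nat \<Rightarrow> 'a list set.
      (\<forall>i. definable_set M UNIV n (E i) \<and> E i \<noteq> {} \<and> E i \<subseteq> D) \<Longrightarrow>
      (\<forall>i j. i \<noteq> j \<longrightarrow> E i \<inter> E j = {}) \<Longrightarrow>
      \<exists>i. has_morley_rank M n (E i)) \<Longrightarrow>
   has_morley_rank M n D"

definition totally_transcendental :: "('f, 'r, 'a) struct \<Rightarrow> bool" where
  "totally_transcendental M \<longleftrightarrow> (\<forall>n D. definable_set M UNIV n D \<longrightarrow> has_morley_rank M n D)"

text \<open>Every 0-definable equivalence relation is the kernel of a 0-definable map: this form of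
  elimination of imaginaries is the one that provides definable quotient maps.\<close>

definition eliminates_imaginaries :: "('f, 'r, 'a) struct \<Rightarrow> bool" where
  "eliminates_imaginaries M \<longleftrightarrow>
    (\<forall>n E. equiv (tuples n) E \<and> definable_set M {} (n + n) {x @ y | x y. (x, y) \<in> E} \<longrightarrow>
      (\<exists>f. definable_map M {} (tuples n) f \<and>
        (\<forall>x \<in> tuples n. \<forall>y \<in> tuples n. f x = f y \<longleftrightarrow> (x, y) \<in> E)))"

definition saturated :: "('f, 'r, 'a) struct \<Rightarrow> 'k rel \<Rightarrow> bool" where
  "saturated M \<kappa> \<longleftrightarrow>
    (\<forall>C n q. |C| <o \<kappa> \<and> q \<subseteq> param_formulas M C n \<and>
        (\<forall>q0. finite q0 \<and> q0 \<subseteq> q \<longrightarrow> realizations M n q0 \<noteq> {}) \<longrightarrow>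
      realizations M n q \<noteq> {})"

definition automorphism :: "('f, 'r, 'a) struct \<Rightarrow> ('a \<Rightarrow> 'a) \<Rightarrow> bool" where
  "automorphism M \<sigma> \<longleftrightarrow> bij \<sigma> \<and>
    (\<forall>f xs. (f, length xs) \<in> fsyms M \<longrightarrow> \<sigma> (fint M f xs) = fint M f (map \<sigma> xs)) \<and>
    (\<forall>r xs. (r, length xs) \<in> rsyms M \<longrightarrow> (rint M r xs \<longleftrightarrow> rint M r (map \<sigma> xs)))"

definition elementary_map :: "('f, 'r, 'a) struct \<Rightarrow> 'a set \<Rightarrow> ('a \<Rightarrow> 'a) \<Rightarrow> bool" where
  "elementary_map M C f \<longleftrightarrow>
    (\<forall>cs \<phi>. set cs \<subseteq> C \<and> \<phi> \<in> formulas M (length cs) \<longrightarrow>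
      (sat M ((!) cs) \<phi> \<longleftrightarrow> sat M ((!) (map f cs)) \<phi>))"

definition strongly_homogeneous :: "('f, 'r, 'a) struct \<Rightarrow> 'k rel \<Rightarrow> bool" where
  "strongly_homogeneous M \<kappa> \<longleftrightarrow>
    (\<forall>C f. |C| <o \<kappa> \<and> elementary_map M C f \<longrightarrow>
      (\<exists>\<sigma>. automorphism M \<sigma> \<and> (\<forall>c \<in> C. \<sigma> c = f c)))"

text \<open>\<open>\<kappa>\<close> bounds the size of small sets: \<open>C\<close> is small iff \<open>|C| <o \<kappa>\<close>.\<close>

definition monster_model ::
    "('f, 'r, 'a) struct \<Rightarrow> ('f, 'r) fm set \<Rightarrow> 'k rel \<Rightarrow> bool" where
  "monster_model M T \<kappa> \<longleftrightarrow> models M T \<and> Card_order \<kappa> \<and> |{\<phi>. wff M \<phi>}| <o \<kappa> \<and>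
    saturated M \<kappa> \<and> strongly_homogeneous M \<kappa>"


section \<open>Internality, orthogonality, Galois extensions\<close>

definition strongly_internal ::
    "('f, 'r, 'a) struct \<Rightarrow> 'a set \<Rightarrow> 'a list set \<Rightarrow> nat \<Rightarrow> (('f, 'r) fm \<times> 'a list) set \<Rightarrow> bool"
  where
  "strongly_internal M A X n q \<longleftrightarrow>
    (\<forall>b1 \<in> realizations M n q. \<forall>b2 \<in> realizations M n q.
      set b2 \<subseteq> dcl M (set b1 \<union> A \<union> coords X))"

text \<open>
  Weak orthogonality is defined by \<open>X(dcl(A,b)) = X(A)\<close> for realizations \<open>b\<close> of \<open>q\<close>. The other
  usual definition, that \<open>q\<close> has a unique extension to a complete type over \<open>A \<union> X(U)\<close>, implies
  this one. For totally transcendental theories the two agree if \<open>X\<close> is closed under coding of its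
  own imaginaries, but not for arbitrary \<open>X\<close>: a code for a finite subset of \<open>X\<close> can lie in
  \<open>dcl(A,b)\<close> without the elements of the subset doing so. That \<open>H(B) = H(A)\<close> characterizes the
  Galois extensions relative to a group \<open>H\<close> generated by a point of an \<open>H\<close>-torsor is true for the
  version with points only.
\<close>

definition weakly_orthogonal ::
    "('f, 'r, 'a) struct \<Rightarrow> 'a set \<Rightarrow> 'a list set \<Rightarrow> nat \<Rightarrow> (('f, 'r) fm \<times> 'a list) set \<Rightarrow> bool"
  where
  "weakly_orthogonal M A X n q \<longleftrightarrow>
    (\<forall>b \<in> realizations M n q. points X (dcl M (A \<union> set b)) = points X A)"

definition strong_weak_type ::
    "('f, 'r, 'a) struct \<Rightarrow> 'a set \<Rightarrow> 'a list set \<Rightarrow> 'a list \<Rightarrow> bool" where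
  "strong_weak_type M A X b \<longleftrightarrow>
    strongly_internal M A X (length b) (tp M A b) \<and>
    weakly_orthogonal M A X (length b) (tp M A b)"

definition galois_extension ::
    "('f, 'r, 'a) struct \<Rightarrow> 'a set \<Rightarrow> 'a list set \<Rightarrow> 'a set \<Rightarrow> bool" where
  "galois_extension M A X B \<longleftrightarrow> (\<exists>b. B = dcl M (A \<union> set b) \<and> strong_weak_type M A X b)"


section \<open>Definable groups and torsors\<close>

definition definable_group :: "('f, 'r, 'a) struct \<Rightarrow> 'a set \<Rightarrow> 'a list monoid \<Rightarrow> bool" where
  "definable_group M A G \<longleftrightarrow> group G \<and>
    (\<exists>n. definable_set M A n (carrier G) \<and>
      definable_set M A (n + n + n)
        {x @ y @ (x \<otimes>\<^bsub>G\<^esub> y) | x y. x \<in> carrier G \<and> y \<in> carrier G})"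

definition definable_subgroup ::
    "('f, 'r, 'a) struct \<Rightarrow> 'a set \<Rightarrow> 'a list monoid \<Rightarrow> 'a list monoid \<Rightarrow> bool" where
  "definable_subgroup M A H G \<longleftrightarrow> definable_group M A H \<and> definable_group M A G \<and>
    subgroup (carrier H) G \<and> (\<forall>x \<in> carrier H. \<forall>y \<in> carrier H. x \<otimes>\<^bsub>H\<^esub> y = x \<otimes>\<^bsub>G\<^esub> y)"

definition right_torsor :: "'b monoid \<Rightarrow> 'c set \<Rightarrow> ('c \<Rightarrow> 'b \<Rightarrow> 'c) \<Rightarrow> bool" where
  "right_torsor G V act \<longleftrightarrow> V \<noteq> {} \<and>
    (\<forall>v \<in> V. \<forall>g \<in> carrier G. act v g \<in> V) \<and>
    (\<forall>v \<in> V. act v \<one>\<^bsub>G\<^esub> = v) \<and>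
    (\<forall>v \<in> V. \<forall>g \<in> carrier G. \<forall>h \<in> carrier G. act (act v g) h = act v (g \<otimes>\<^bsub>G\<^esub> h)) \<and>
    (\<forall>v \<in> V. \<forall>w \<in> V. \<exists>!g. g \<in> carrier G \<and> act v g = w)"

definition definable_torsor ::
    "('f, 'r, 'a) struct \<Rightarrow> 'a set \<Rightarrow> 'a list monoid \<Rightarrow> 'a list set \<Rightarrow>
      ('a list \<Rightarrow> 'a list \<Rightarrow> 'a list) \<Rightarrow> bool" where
  "definable_torsor M A G V act \<longleftrightarrow> right_torsor G V act \<and>
    (\<exists>n m. definable_set M A n V \<and> carrier G \<subseteq> tuples m \<and>
      definable_set M A (n + m + n) {v @ g @ act v g | v g. v \<in> V \<and> g \<in> carrier G})"

definition torsor_iso ::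
    "('f, 'r, 'a) struct \<Rightarrow> 'a set \<Rightarrow> 'a list monoid \<Rightarrow>
      'a list set \<Rightarrow> ('a list \<Rightarrow> 'a list \<Rightarrow> 'a list) \<Rightarrow>
      'a list set \<Rightarrow> ('a list \<Rightarrow> 'a list \<Rightarrow> 'a list) \<Rightarrow> bool" where
  "torsor_iso M A G V act V' act' \<longleftrightarrow>
    (\<exists>f. definable_map M A V f \<and> bij_betw f V V' \<and>
      (\<forall>v \<in> V. \<forall>g \<in> carrier G. f (act v g) = act' (f v) g))"

definition orbit :: "'b monoid \<Rightarrow> ('c \<Rightarrow> 'b \<Rightarrow> 'c) \<Rightarrow> 'c \<Rightarrow> 'c set" where
  "orbit H act w = {act w h | h. h \<in> carrier H}"


section \<open>The group given by the Torsor Theorem\<close>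

text \<open>The permutations \<open>\<sigma>\<close> of \<open>Q\<close> such that \<open>\<sigma>\<close> together with the identity on \<open>C\<close> preserves
  all formulas; the group operation is composition.\<close>

definition elementary_perms ::
    "('f, 'r, 'a) struct \<Rightarrow> 'a set \<Rightarrow> 'a list set \<Rightarrow> ('a list \<Rightarrow> 'a list) monoid" where
  "elementary_perms M C Q = (BijGroup Q)\<lparr>carrier := {\<sigma> \<in> Bij Q.
    \<forall>qs p. set qs \<subseteq> Q \<and> p \<in> param_formulas M C (length (concat qs)) \<longrightarrow>
      (holds M (concat qs) p \<longleftrightarrow> holds M (concat (map \<sigma> qs)) p)}\<rparr>"

definition torsor_theorem_group ::
    "('f, 'r, 'a) struct \<Rightarrow> 'a set \<Rightarrow> 'a list set \<Rightarrow> 'a list set \<Rightarrow>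
      'a list monoid \<Rightarrow> ('a list \<Rightarrow> 'a list \<Rightarrow> 'a list) \<Rightarrow> bool" where
  "torsor_theorem_group M A X Q H act \<longleftrightarrow>
    definable_group M A H \<and> coords (carrier H) \<subseteq> dcl M (A \<union> coords X) \<and>
    elementary_perms M (A \<union> coords X) Q \<cong> H \<and> definable_torsor M A H Q act"


section \<open>The pointed set of torsors up to isomorphism\<close>

definition torsors ::
    "('f, 'r, 'a) struct \<Rightarrow> 'a set \<Rightarrow> 'a list monoid \<Rightarrow>
      ('a list set \<times> ('a list \<Rightarrow> 'a list \<Rightarrow> 'a list)) set" where
  "torsors M A G = {(V, act). definable_torsor M A G V act}"

definition torsor_rel ::
    "('f, 'r, 'a) struct \<Rightarrow> 'a set \<Rightarrow> 'a list monoid \<Rightarrow>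
      ('a list set \<times> ('a list \<Rightarrow> 'a list \<Rightarrow> 'a list)) rel" where
  "torsor_rel M A G = {((V, act), (V', act')).
    definable_torsor M A G V act \<and> definable_torsor M A G V' act' \<and>
    torsor_iso M A G V act V' act'}"

definition torsor_class ::
    "('f, 'r, 'a) struct \<Rightarrow> 'a set \<Rightarrow> 'a list monoid \<Rightarrow>
      'a list set \<Rightarrow> ('a list \<Rightarrow> 'a list \<Rightarrow> 'a list) \<Rightarrow>
      ('a list set \<times> ('a list \<Rightarrow> 'a list \<Rightarrow> 'a list)) set" where
  "torsor_class M A G V act = torsor_rel M A G `` {(V, act)}"

definition H1_def ::
    "('f, 'r, 'a) struct \<Rightarrow> 'a set \<Rightarrow> 'a list monoid \<Rightarrow>
      ('a list set \<times> ('a list \<Rightarrow> 'a list \<Rightarrow> 'a list)) set set" where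
  "H1_def M A G = torsors M A G // torsor_rel M A G"

definition trivial_class ::
    "('f, 'r, 'a) struct \<Rightarrow> 'a set \<Rightarrow> 'a list monoid \<Rightarrow>
      ('a list set \<times> ('a list \<Rightarrow> 'a list \<Rightarrow> 'a list)) set" where
  "trivial_class M A G = torsor_class M A G (carrier G) (mult G)"

text \<open>\<open>\<pi>\<close> is an \<open>A\<close>-definable map on \<open>S\<close> identifying the quotient of \<open>S\<close> by the equivalence
  relation \<open>R\<close> with the set \<open>\<pi> ` S\<close> of real tuples.\<close>

definition quotient_map ::
    "('f, 'r, 'a) struct \<Rightarrow> 'a set \<Rightarrow> 'a list set \<Rightarrow> ('a list \<Rightarrow> 'a list \<Rightarrow> bool) \<Rightarrow>
      ('a list \<Rightarrow> 'a list) \<Rightarrow> bool" where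
  "quotient_map M A S R \<pi> \<longleftrightarrow> definable_map M A S \<pi> \<and> (\<forall>x \<in> S. \<forall>y \<in> S. \<pi> x = \<pi> y \<longleftrightarrow> R x y)"

text \<open>The quotient of \<open>V \<times> G\<close> by \<open>(v h, g) \<sim> (v, h g)\<close>. A pair \<open>(v, g)\<close> is the tuple \<open>v @ g\<close>.\<close>

definition induced_torsor ::
    "('f, 'r, 'a) struct \<Rightarrow> 'a set \<Rightarrow> 'a list monoid \<Rightarrow> 'a list monoid \<Rightarrow>
      'a list set \<Rightarrow> ('a list \<Rightarrow> 'a list \<Rightarrow> 'a list) \<Rightarrow>
      'a list set \<Rightarrow> ('a list \<Rightarrow> 'a list \<Rightarrow> 'a list) \<Rightarrow> bool" where
  "induced_torsor M A H G V act W actW \<longleftrightarrow>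
    (\<exists>\<pi>. quotient_map M A {v @ g | v g. v \<in> V \<and> g \<in> carrier G}
          (\<lambda>x y. \<exists>v1 \<in> V. \<exists>g1 \<in> carrier G. \<exists>v2 \<in> V. \<exists>g2 \<in> carrier G. x = v1 @ g1 \<and> y = v2 @ g2 \<and>
            (\<exists>h \<in> carrier H. v2 = act v1 h \<and> g1 = h \<otimes>\<^bsub>G\<^esub> g2)) \<pi> \<and>
        W = {\<pi> (v @ g) | v g. v \<in> V \<and> g \<in> carrier G} \<and>
        (\<forall>v \<in> V. \<forall>g \<in> carrier G. \<forall>g' \<in> carrier G.
          actW (\<pi> (v @ g)) g' = \<pi> (v @ (g \<otimes>\<^bsub>G\<^esub> g'))))"

text \<open>The map on classes: the class of the torsors induced by the members of the class \<open>c\<close>.\<close>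

definition iota1 ::
    "('f, 'r, 'a) struct \<Rightarrow> 'a set \<Rightarrow> 'a list monoid \<Rightarrow> 'a list monoid \<Rightarrow>
      ('a list set \<times> ('a list \<Rightarrow> 'a list \<Rightarrow> 'a list)) set \<Rightarrow>
      ('a list set \<times> ('a list \<Rightarrow> 'a list \<Rightarrow> 'a list)) set" where
  "iota1 M A H G c =
    torsor_rel M A G `` {(W, actW). \<exists>(V, act) \<in> c. induced_torsor M A H G V act W actW}"


section \<open>Primitives\<close>

definition GH_primitive ::
    "('f, 'r, 'a) struct \<Rightarrow> 'a set \<Rightarrow> 'a list monoid \<Rightarrow> 'a list monoid \<Rightarrow> 'a list \<Rightarrow> bool" where
  "GH_primitive M A G H a \<longleftrightarrow> a \<in> carrier G \<and>
    (\<exists>\<pi>. quotient_map M A (carrier G)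
          (\<lambda>x y. x <#\<^bsub>G\<^esub> carrier H = y <#\<^bsub>G\<^esub> carrier H) \<pi> \<and>
        \<pi> a \<in> points (\<pi> ` carrier G) A)"

definition WGH_primitive ::
    "('f, 'r, 'a) struct \<Rightarrow> 'a set \<Rightarrow> 'a list monoid \<Rightarrow> 'a list set \<Rightarrow>
      ('a list \<Rightarrow> 'a list \<Rightarrow> 'a list) \<Rightarrow> 'a list \<Rightarrow> bool" where
  "WGH_primitive M A H W actW a \<longleftrightarrow> a \<in> W \<and>
    (\<exists>\<pi>. quotient_map M A W (\<lambda>x y. orbit H actW x = orbit H actW y) \<pi> \<and>
        \<pi> a \<in> points (\<pi> ` W) A)"

end

theory Submission
  imports Defs
begin

text \<open>
  The \<open>G\<close>-torsor \<open>W = (Q \<times> G)/\<sim>\<close> exists as a definable set by elimination of imaginaries, and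
  \<open>q \<mapsto> [q, 1]\<close> is an \<open>A\<close>-definable injective \<open>H\<close>-equivariant map from \<open>Q\<close> onto an \<open>H\<close>-orbit of \<open>W\<close>.
  The image of \<open>b\<close> is interdefinable with \<open>b\<close> over \<open>A\<close>, and its orbit is \<open>A\<close>-definable, hence an
  \<open>A\<close>-point of \<open>W/H\<close>. Trivializations \<open>W \<cong> G\<close> correspond to equivariant maps \<open>\<theta> : Q \<rightarrow> G\<close> by
  \<open>[q, g] \<mapsto> \<theta>(q) g\<close>, and the image of such a map is a coset of \<open>H\<close>.

  For the first part, a realization of \<open>tp(b/A)\<close> lies in \<open>Q\<close> and so differs from any other one by
  an element of \<open>H\<close>, which is strong internality; weak orthogonality is the condition on points,
  which depends on \<open>tp(b/A)\<close> only.
\<close>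

section \<open>Closure properties of definable sets\<close>

text \<open>Definability is the main burden: each set, graph and relation is exhibited as built from
  definable ones by Boolean operations, substitution of coordinates and quantification over
  definable sets, and \<open>dcl\<close> enters through definable singletons. Elimination of
  imaginaries speaks of parameter-free equivalence relations on all tuples of one length, whereas
  the quotients wanted are those of \<open>A\<close>-definable sets by \<open>A\<close>-definable
  relations; the parameters are therefore carried along as extra coordinates. Neither the quotient
  map nor the torsor representing a class is canonical: \<open>iota1\<close> collects all torsors
  induced by all members of a class. What survives these choices is the existence of an
  \<open>A\<close>-definable equivariant embedding of the \<open>H\<close>-torsor into
  \<open>G\<close>, since such an embedding can be transported along isomorphisms. Triviality of the
  image class, the coset and the primitive are each compared with it. Likewise a Galois extension
  may be generated by a tuple other than the point of the torsor, so weak orthogonality has to be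
  expressed by \<open>B\<close> alone.\<close>

primrec rename_trm :: "(nat \<Rightarrow> nat) \<Rightarrow> 'f trm \<Rightarrow> 'f trm" where
  "rename_trm f (Var i) = Var (f i)"
| "rename_trm f (Fn g ts) = Fn g (map (rename_trm f) ts)"

text \<open>Only variables are ever put in place of variables: parameters are the values of trailing
  variables, so inserting a parameter is a renaming as well.\<close>

primrec rename_fm :: "(nat \<Rightarrow> nat) \<Rightarrow> ('f, 'r) fm \<Rightarrow> ('f, 'r) fm" where
  "rename_fm f (Eq s t) = Eq (rename_trm f s) (rename_trm f t)"
| "rename_fm f (Rel r ts) = Rel r (map (rename_trm f) ts)"
| "rename_fm f (Neg \<phi>) = Neg (rename_fm f \<phi>)"
| "rename_fm f (Conj \<phi> \<psi>) = Conj (rename_fm f \<phi>) (rename_fm f \<psi>)"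
| "rename_fm f (Ex \<phi>) = Ex (rename_fm (case_nat 0 (Suc \<circ> f)) \<phi>)"

lemma fvt_rename [simp]: "fvt (rename_trm f t) = f ` fvt t"
  by (induction t) auto

lemma fv_rename [simp]: "fv (rename_fm f \<phi>) = f ` fv \<phi>"
proof (induction \<phi> arbitrary: f)
  case (Ex \<phi>)
  have "Suc x \<in> case_nat 0 (Suc \<circ> f) ` fv \<phi> \<longleftrightarrow> x \<in> f ` {i. Suc i \<in> fv \<phi>}" for x
  proof
    assume "Suc x \<in> case_nat 0 (Suc \<circ> f) ` fv \<phi>"
    then obtain j where "j \<in> fv \<phi>" "Suc x = case_nat 0 (Suc \<circ> f) j"
      by blast
    then show "x \<in> f ` {i. Suc i \<in> fv \<phi>}"
      by (cases j) auto
  next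
    assume "x \<in> f ` {i. Suc i \<in> fv \<phi>}"
    then obtain i where "Suc i \<in> fv \<phi>" "x = f i"
      by blast
    then show "Suc x \<in> case_nat 0 (Suc \<circ> f) ` fv \<phi>"
      by (intro image_eqI[of _ _ "Suc i"]) auto
  qed
  then show ?case
    by (simp add: Ex set_eq_iff)
qed auto

lemma wft_rename [simp]: "wft L (rename_trm f t) \<longleftrightarrow> wft L t"
  by (induction t) (auto simp: list_all_iff)

lemma wff_rename [simp]: "wff L (rename_fm f \<phi>) \<longleftrightarrow> wff L \<phi>"
  by (induction \<phi> arbitrary: f) (auto simp: list_all_iff)

lemma eval_rename [simp]: "eval M e (rename_trm f t) = eval M (\<lambda>i. e (f i)) t"
proof (induction t)
  case (Fn g ts)
  then have "map (eval M e \<circ> rename_trm f) ts = map (eval M (\<lambda>i. e (f i))) ts"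
    by simp
  then show ?case
    by (metis eval.simps(2) map_map rename_trm.simps(2))
qed auto

lemma case_nat_comp: "(\<lambda>i. case_nat a e (case_nat 0 (Suc \<circ> f) i)) = case_nat a (\<lambda>i. e (f i))"
  by (auto simp: fun_eq_iff split: nat.splits)

lemma sat_rename [simp]: "sat M e (rename_fm f \<phi>) \<longleftrightarrow> sat M (\<lambda>i. e (f i)) \<phi>"
proof (induction \<phi> arbitrary: e f)
  case (Rel r ts)
  have "map (eval M e \<circ> rename_trm f) ts = map (eval M (\<lambda>i. e (f i))) ts"
    by simp
  then show ?case
    by (metis sat.simps(2) map_map rename_fm.simps(2))
qed (auto simp: case_nat_comp)

lemma eval_cong: "(\<And>i. i \<in> fvt t \<Longrightarrow> e i = e' i) \<Longrightarrow> eval M e t = eval M e' t"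
proof (induction t)
  case (Fn g ts)
  then have "map (eval M e) ts = map (eval M e') ts"
    by auto
  then show ?case
    by (metis eval.simps(2))
qed auto

lemma sat_cong: "(\<And>i. i \<in> fv \<phi> \<Longrightarrow> e i = e' i) \<Longrightarrow> sat M e \<phi> \<longleftrightarrow> sat M e' \<phi>"
proof (induction \<phi> arbitrary: e e')
  case (Eq s t)
  then show ?case using eval_cong[of s e e' M] eval_cong[of t e e' M] by auto
next
  case (Rel r ts)
  then have "map (eval M e) ts = map (eval M e') ts"
    by (auto intro!: eval_cong)
  then show ?case
    by (metis sat.simps(2))
next
  case (Neg \<phi>)
  then show ?case by (metis fv.simps(3) sat.simps(3))
next
  case (Conj \<phi> \<psi>)
  then show ?case by (metis Un_iff fv.simps(4) sat.simps(4))
next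
  case (Ex \<phi>)
  have "sat M (case_nat a e) \<phi> \<longleftrightarrow> sat M (case_nat a e') \<phi>" for a
    by (rule Ex.IH) (use Ex.prems in \<open>auto split: nat.splits\<close>)
  then show ?case
    by simp
qed

text \<open>Renaming \<open>i\<close> to \<open>j\<close> works because \<open>j\<close> is chosen
  before \<open>z\<close>: each coordinate of the assignment \<open>t z\<close> is read off
  \<open>z @ bs\<close> at one fixed place.\<close>

lemma formula_subst:
  assumes "\<phi> \<in> formulas M n"
    and "\<And>i. i < n \<Longrightarrow> \<exists>j < N + length bs. \<forall>z. length z = N \<longrightarrow> (z @ bs) ! j = t z i"
  obtains \<psi> where "\<psi> \<in> formulas M (N + length bs)"
    "\<forall>z. length z = N \<longrightarrow> sat M ((!) (z @ bs)) \<psi> \<longleftrightarrow> sat M (t z) \<phi>"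
proof -
  obtain f where f: "\<And>i. i < n \<Longrightarrow> f i < N + length bs \<and> (\<forall>z. length z = N \<longrightarrow> (z @ bs) ! f i = t z i)"
    using assms(2) by metis
  have \<phi>: "wff M \<phi>" "\<And>i. i \<in> fv \<phi> \<Longrightarrow> i < n"
    using assms(1) by (auto simp: formulas_def)
  show thesis
  proof (rule that)
    show "rename_fm f \<phi> \<in> formulas M (N + length bs)"
      using \<phi> f by (auto simp: formulas_def)
    have "sat M ((!) (z @ bs)) (rename_fm f \<phi>) \<longleftrightarrow> sat M (t z) \<phi>" if "length z = N" for z
      unfolding sat_rename by (rule sat_cong) (use \<phi> f that in blast)
    then show "\<forall>z. length z = N \<longrightarrow> sat M ((!) (z @ bs)) (rename_fm f \<phi>) \<longleftrightarrow> sat M (t z) \<phi>"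
      by blast
  qed
qed

section \<open>Definable sets and substitution of tuples\<close>

lemma tuplesD [dest]: "x \<in> tuples n \<Longrightarrow> length x = n"
  by (simp add: tuples_def)

lemma definable_setE:
  assumes "definable_set M C n X"
  obtains as \<phi> where "set as \<subseteq> C" "\<phi> \<in> formulas M (n + length as)"
    "\<forall>x. x \<in> X \<longleftrightarrow> length x = n \<and> sat M ((!) (x @ as)) \<phi>"
proof -
  obtain p where p: "p \<in> param_formulas M C n" "X = {xs \<in> tuples n. holds M xs p}"
    using assms unfolding definable_set_def by blast
  then show thesis
    by (intro that[of "snd p" "fst p"]) (auto simp: param_formulas_def holds_def tuples_def)
qed

lemma definable_setI:
  assumes "set as \<subseteq> C" "\<phi> \<in> formulas M (n + length as)"
    "\<And>x. x \<in> X \<longleftrightarrow> length x = n \<and> sat M ((!) (x @ as)) \<phi>"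
  shows "definable_set M C n X"
proof -
  have "(\<phi>, as) \<in> param_formulas M C n"
    using assms(1,2) by (simp add: param_formulas_def)
  moreover have "X = {xs \<in> tuples n. holds M xs (\<phi>, as)}"
    by (simp add: set_eq_iff assms(3) tuples_def holds_def)
  ultimately show ?thesis
    unfolding definable_set_def by (rule bexI[rotated])
qed

lemma definable_set_subset: "definable_set M C n X \<Longrightarrow> X \<subseteq> tuples n"
  unfolding definable_set_def by auto

lemma definable_set_length: "definable_set M C n X \<Longrightarrow> x \<in> X \<Longrightarrow> length x = n"
  using definable_set_subset unfolding tuples_def by blast

text \<open>A coordinate of a term is a variable (\<open>Inl\<close>) or a parameter (\<open>Inr\<close>).\<close>

definition tuple_term :: "'a set \<Rightarrow> nat \<Rightarrow> ('a list \<Rightarrow> 'a list) \<Rightarrow> bool" where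
  "tuple_term C N t \<longleftrightarrow> (\<exists>xs. set xs \<subseteq> Inl ` {..<N} \<union> Inr ` C \<and>
    (\<forall>z \<in> tuples N. t z = map (case_sum ((!) z) id) xs))"

lemma tuple_term_id: "tuple_term C N (\<lambda>z. z)"
  unfolding tuple_term_def
  by (rule exI[of _ "map Inl [0..<N]"]) (auto simp: tuples_def intro: nth_equalityI)

lemma tuple_term_const: "set c \<subseteq> C \<Longrightarrow> tuple_term C N (\<lambda>z. c)"
  unfolding tuple_term_def
  by (rule exI[of _ "map Inr c"]) (auto simp: comp_def)

lemma tuple_term_take: "tuple_term C N t \<Longrightarrow> tuple_term C N (\<lambda>z. take k (t z))"
proof -
  assume "tuple_term C N t"
  then obtain xs where "set xs \<subseteq> Inl ` {..<N} \<union> Inr ` C"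
    "\<forall>z \<in> tuples N. t z = map (case_sum ((!) z) id) xs"
    unfolding tuple_term_def by blast
  then show ?thesis
    unfolding tuple_term_def
    by (intro exI[of _ "take k xs"] conjI) (auto simp: take_map dest: in_set_takeD)
qed

lemma tuple_term_drop: "tuple_term C N t \<Longrightarrow> tuple_term C N (\<lambda>z. drop k (t z))"
proof -
  assume "tuple_term C N t"
  then obtain xs where "set xs \<subseteq> Inl ` {..<N} \<union> Inr ` C"
    "\<forall>z \<in> tuples N. t z = map (case_sum ((!) z) id) xs"
    unfolding tuple_term_def by blast
  then show ?thesis
    unfolding tuple_term_def
    by (intro exI[of _ "drop k xs"] conjI) (auto simp: drop_map dest: in_set_dropD)
qed

lemma tuple_term_append:
  assumes "tuple_term C N s" "tuple_term C N t"
  shows "tuple_term C N (\<lambda>z. s z @ t z)"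
proof -
  obtain xs ys where "set xs \<subseteq> Inl ` {..<N} \<union> Inr ` C" "set ys \<subseteq> Inl ` {..<N} \<union> Inr ` C"
    "\<forall>z \<in> tuples N. s z = map (case_sum ((!) z) id) xs"
    "\<forall>z \<in> tuples N. t z = map (case_sum ((!) z) id) ys"
    using assms unfolding tuple_term_def by auto
  then show ?thesis
    unfolding tuple_term_def by (intro exI[of _ "xs @ ys"]) auto
qed

text \<open>Predicates in place of sets let definability be proved by introduction rules that follow
  the shape of a condition. All variables are collected in a single tuple \<open>z\<close> and
  recovered from it by \<open>take\<close> and \<open>drop\<close>.\<close>

definition dpred :: "('f, 'r, 'a) struct \<Rightarrow> 'a set \<Rightarrow> nat \<Rightarrow> ('a list \<Rightarrow> bool) \<Rightarrow> bool" where
  "dpred M C N P \<longleftrightarrow> definable_set M C N {z \<in> tuples N. P z}"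

lemma dpred_cong:
  "(\<And>z. length z = N \<Longrightarrow> P z \<longleftrightarrow> Q z) \<Longrightarrow> dpred M C N P \<longleftrightarrow> dpred M C N Q"
proof -
  assume "\<And>z. length z = N \<Longrightarrow> P z \<longleftrightarrow> Q z"
  then have "{z \<in> tuples N. P z} = {z \<in> tuples N. Q z}"
    unfolding tuples_def by blast
  then show ?thesis
    by (simp add: dpred_def)
qed

lemma dpred_iff:
  "dpred M C N P \<longleftrightarrow> (\<exists>\<phi> as. set as \<subseteq> C \<and> \<phi> \<in> formulas M (N + length as) \<and>
    (\<forall>z. length z = N \<longrightarrow> P z \<longleftrightarrow> sat M ((!) (z @ as)) \<phi>))" (is "_ \<longleftrightarrow> ?R")
proof
  assume "dpred M C N P"
  then show ?R
    unfolding dpred_def by (elim definable_setE) (auto simp: tuples_def)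
next
  assume ?R
  then show "dpred M C N P"
    unfolding dpred_def by (elim exE conjE) (rule definable_setI, auto simp: tuples_def)
qed

lemma dpred_not:
  assumes "dpred M C N P" shows "dpred M C N (\<lambda>z. \<not> P z)"
proof -
  obtain \<phi> as where "set as \<subseteq> C" "\<phi> \<in> formulas M (N + length as)"
    "\<And>z. length z = N \<Longrightarrow> P z \<longleftrightarrow> sat M ((!) (z @ as)) \<phi>"
    using assms unfolding dpred_iff by auto
  then show ?thesis
    unfolding dpred_iff
    by (intro exI[of _ "Neg \<phi>"] exI[of _ as]) (auto simp: formulas_def)
qed

text \<open>A conjunction has one parameter list, so both conjuncts must first be rewritten over a
  common one. Inclusion of the underlying sets is enough, because each parameter can be looked up at
  any of its occurrences in \<open>bs\<close>.\<close>

lemma formula_more_params: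
  assumes "\<phi> \<in> formulas M (N + length as)" "set as \<subseteq> set bs"
  obtains \<psi> where "\<psi> \<in> formulas M (N + length bs)"
    "\<forall>z. length z = N \<longrightarrow> sat M ((!) (z @ bs)) \<psi> \<longleftrightarrow> sat M ((!) (z @ as)) \<phi>"
proof (rule formula_subst[OF assms(1)])
  fix i assume i: "i < N + length as"
  show "\<exists>j < N + length bs. \<forall>z. length z = N \<longrightarrow> (z @ bs) ! j = (z @ as) ! i"
  proof (cases "i < N")
    case True
    then show ?thesis
      by (intro exI[of _ i]) (simp add: nth_append)
  next
    case False
    then have "as ! (i - N) \<in> set bs"
      using i assms(2) by (auto intro: nth_mem)
    then obtain j where "j < length bs" "bs ! j = as ! (i - N)"
      by (metis in_set_conv_nth)
    then show ?thesis
      using False by (intro exI[of _ "N + j"]) (simp add: nth_append)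
  qed
qed (use that in blast)

lemma dpred_conj:
  assumes "dpred M C N P" "dpred M C N Q"
  shows "dpred M C N (\<lambda>z. P z \<and> Q z)"
proof -
  obtain \<phi> as where 1: "set as \<subseteq> C" "\<phi> \<in> formulas M (N + length as)"
    "\<And>z. length z = N \<Longrightarrow> P z \<longleftrightarrow> sat M ((!) (z @ as)) \<phi>"
    using assms(1) unfolding dpred_iff by auto
  obtain \<psi> bs where 2: "set bs \<subseteq> C" "\<psi> \<in> formulas M (N + length bs)"
    "\<And>z. length z = N \<Longrightarrow> Q z \<longleftrightarrow> sat M ((!) (z @ bs)) \<psi>"
    using assms(2) unfolding dpred_iff by auto
  obtain \<phi>' where 3: "\<phi>' \<in> formulas M (N + length (as @ bs))"
    "\<And>z. length z = N \<Longrightarrow> sat M ((!) (z @ (as @ bs))) \<phi>' \<longleftrightarrow> sat M ((!) (z @ as)) \<phi>"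
    using formula_more_params[OF 1(2), of "as @ bs"] by auto
  obtain \<psi>' where 4: "\<psi>' \<in> formulas M (N + length (as @ bs))"
    "\<And>z. length z = N \<Longrightarrow> sat M ((!) (z @ (as @ bs))) \<psi>' \<longleftrightarrow> sat M ((!) (z @ bs)) \<psi>"
    using formula_more_params[OF 2(2), of "as @ bs"] by auto
  show ?thesis
    unfolding dpred_iff
    using 1 2 3 4 by (intro exI[of _ "Conj \<phi>' \<psi>'"] exI[of _ "as @ bs"]) (auto simp: formulas_def)
qed

lemma dpred_disj: "dpred M C N P \<Longrightarrow> dpred M C N Q \<Longrightarrow> dpred M C N (\<lambda>z. P z \<or> Q z)"
proof -
  assume "dpred M C N P" "dpred M C N Q"
  then have "dpred M C N (\<lambda>z. \<not> (\<not> P z \<and> \<not> Q z))"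
    by (intro dpred_not dpred_conj)
  then show ?thesis
    by simp
qed

lemma dpred_imp: "dpred M C N P \<Longrightarrow> dpred M C N Q \<Longrightarrow> dpred M C N (\<lambda>z. P z \<longrightarrow> Q z)"
  unfolding imp_conv_disj by (intro dpred_not dpred_disj)

lemma dpred_True: "dpred M C N (\<lambda>z. True)"
  \<comment> \<open>The formula is closed: for \<open>N = 0\<close> without parameters no free
    variable may occur.\<close>
  unfolding dpred_iff
  by (intro exI[of _ "Ex (Eq (Var 0) (Var 0))"] exI[of _ "[]"]) (auto simp: formulas_def)

lemma dpred_const: "dpred M C N (\<lambda>z. b)"
  using dpred_True dpred_not[OF dpred_True] by (cases b) auto

lemma definable_tuples: "definable_set M C n (tuples n)"
  using dpred_True[of M C n] unfolding dpred_def by simp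

text \<open>Projections, permutations of coordinates, diagonals and insertion of constants are all
  instances of this one substitution.\<close>

lemma dpred_mem:
  assumes "definable_set M C n X" "tuple_term C N t"
  shows "dpred M C N (\<lambda>z. t z \<in> X)"
proof -
  obtain xs where xs: "set xs \<subseteq> Inl ` {..<N} \<union> Inr ` C"
    "\<And>z. length z = N \<Longrightarrow> t z = map (case_sum ((!) z) id) xs"
    using assms(2) unfolding tuple_term_def tuples_def mem_Collect_eq by blast
  obtain as \<phi> where 1: "set as \<subseteq> C" "\<phi> \<in> formulas M (n + length as)"
    "\<forall>x. x \<in> X \<longleftrightarrow> length x = n \<and> sat M ((!) (x @ as)) \<phi>"
    by (rule definable_setE[OF assms(1)])
  show ?thesis
  proof (cases "length xs = n")
    case False
    \<comment> \<open>A term of the wrong length never meets \<open>X\<close>, and the predicate is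
      then constantly false. Treating this case here spares the applications a side condition on
      lengths.\<close>
    then have "length z = N \<Longrightarrow> t z \<notin> X" for z
      using 1(3) xs(2) by simp
    then have "dpred M C N (\<lambda>z. t z \<in> X) \<longleftrightarrow> dpred M C N (\<lambda>z. False)"
      by (intro dpred_cong) blast
    then show ?thesis
      by (simp add: dpred_const)
  next
    case True
    \<comment> \<open>The parameters of \<open>X\<close> followed by the constants of the term:
      together they supply every entry of \<open>t z @ as\<close> that does not come from
      \<open>z\<close>.\<close>
    define bs where "bs = as @ concat (map (case_sum (\<lambda>_. []) (\<lambda>c. [c])) xs)"
    have bs: "set bs \<subseteq> C"
    proof
      fix c assume "c \<in> set bs"
      then consider "c \<in> set as" | "Inr c \<in> set xs"
        by (auto simp: bs_def split: sum.splits)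
      then show "c \<in> C"
        using 1(1) xs(1) by cases auto
    qed
    have "\<exists>j < N + length bs. \<forall>z. length z = N \<longrightarrow> (z @ bs) ! j = (t z @ as) ! i"
      if i: "i < n + length as" for i
    proof (cases "i < n")
      case False
      then obtain k where "i = n + k" "k < length as"
        using i by (metis add_less_cancel_left le_Suc_ex not_less)
      then show ?thesis
        using True xs(2) by (intro exI[of _ "N + k"]) (simp add: nth_append bs_def)
    next
      case i: True
      have mem: "xs ! i \<in> set xs"
        using i True by simp
      show ?thesis
      proof (cases "xs ! i")
        case (Inl j)
        then have "j < N"
          using mem xs(1) by auto
        then show ?thesis
          using True i Inl xs(2) by (intro exI[of _ j]) (simp add: nth_append)
      next
        case (Inr c)
        then have "c \<in> set bs"
          using mem by (auto simp: bs_def intro!: bexI[of _ "xs ! i"])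
        then obtain j where "j < length bs" "bs ! j = c"
          by (metis in_set_conv_nth)
        then show ?thesis
          using True i Inr xs(2) by (intro exI[of _ "N + j"]) (simp add: nth_append)
      qed
    qed
    then obtain \<psi> where 2: "\<psi> \<in> formulas M (N + length bs)"
      and 3: "\<forall>z. length z = N \<longrightarrow> sat M ((!) (z @ bs)) \<psi> \<longleftrightarrow> sat M ((!) (t z @ as)) \<phi>"
      by (rule formula_subst[where t = "\<lambda>z. (!) (t z @ as)", OF 1(2)])
    have "t z \<in> X \<longleftrightarrow> sat M ((!) (z @ bs)) \<psi>" if "length z = N" for z
      using 3 that 1(3) True xs(2)[OF that] by simp
    then show ?thesis
      unfolding dpred_iff using 2 bs by blast
  qed
qed

lemma dpred_ex1:
  assumes "dpred M C (Suc N) P"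
  shows "dpred M C N (\<lambda>z. \<exists>a. P (z @ [a]))"
proof -
  obtain \<phi> as where 1: "set as \<subseteq> C" "\<phi> \<in> formulas M (Suc N + length as)"
    "\<And>z. length z = Suc N \<Longrightarrow> P z \<longleftrightarrow> sat M ((!) (z @ as)) \<phi>"
    using assms unfolding dpred_iff by auto
  \<comment> \<open>The witness sits at position \<open>N\<close> of \<open>z @ [a] @ as\<close> and
    becomes the bound index 0, so the entries of \<open>z\<close> move up by one. The parameters
    keep their index, as the position freed at \<open>N\<close> and the shift by the binder
    cancel.\<close>
  define g where "g = (\<lambda>i. if i < N then Suc i else if i = N then 0 else i)"
  have "g i < Suc (N + length as)" if "i \<in> fv \<phi>" for i
    using 1(2) that by (auto simp: formulas_def g_def)
  then have "Ex (rename_fm g \<phi>) \<in> formulas M (N + length as)"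
    using 1(2) by (auto simp: formulas_def) (metis Suc_less_eq)
  moreover have "sat M ((!) (z @ as)) (Ex (rename_fm g \<phi>)) \<longleftrightarrow> (\<exists>a. P (z @ [a]))" if z: "length z = N" for z
  proof -
    have "(\<lambda>i. case_nat a ((!) (z @ as)) (g i)) = (!) ((z @ [a]) @ as)" for a
      using z by (auto simp: fun_eq_iff g_def nth_append nth_Cons' split: nat.splits)
    then show ?thesis
      using z 1(3) by simp
  qed
  ultimately show ?thesis
    unfolding dpred_iff using 1(1) by metis
qed

lemma dpred_ex_tuple:
  "dpred M C (N + n) P \<Longrightarrow> dpred M C N (\<lambda>z. \<exists>y \<in> tuples n. P (z @ y))"
proof (induction n arbitrary: P)
  case 0
  then show ?case by (simp add: tuples_def)
next
  case (Suc n)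
  have "dpred M C N (\<lambda>z. \<exists>y\<in>tuples n. \<exists>a. P ((z @ y) @ [a]))"
    by (rule Suc.IH, rule dpred_ex1) (use Suc.prems in simp)
  moreover have "(\<exists>y\<in>tuples n. \<exists>a. P ((z @ y) @ [a])) \<longleftrightarrow> (\<exists>y\<in>tuples (Suc n). P (z @ y))" for z
  proof
    assume "\<exists>y\<in>tuples n. \<exists>a. P ((z @ y) @ [a])"
    then obtain y a where "length y = n" "P (z @ (y @ [a]))"
      by auto
    then show "\<exists>y\<in>tuples (Suc n). P (z @ y)"
      by (intro bexI[of _ "y @ [a]"]) (auto simp: tuples_def)
  next
    assume "\<exists>y\<in>tuples (Suc n). P (z @ y)"
    then obtain y where "length y = Suc n" "P (z @ y)"
      by auto
    then show "\<exists>y\<in>tuples n. \<exists>a. P ((z @ y) @ [a])"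
      by (cases y rule: rev_cases) (auto simp: tuples_def)
  qed
  ultimately show ?case
    by simp
qed

text \<open>The bound tuple becomes the tail of a longer tuple. With the body as a binary
  \<open>P\<close>, unification reads it off the goal, and nested quantifiers unwind from the
  outside in.\<close>

lemma dpred_ex:
  assumes X: "definable_set M C n X"
    and P: "dpred M C (N + n) (\<lambda>z. P (take N z) (drop N z))"
  shows "dpred M C N (\<lambda>z. \<exists>y \<in> X. P z y)"
proof -
  have "dpred M C (N + n) (\<lambda>z. drop N z \<in> X \<and> P (take N z) (drop N z))"
    by (intro dpred_conj dpred_mem[OF X] tuple_term_drop tuple_term_id P)
  from dpred_ex_tuple[OF this] show ?thesis
    by (rule dpred_cong[THEN iffD1, rotated]) (use X in \<open>auto dest: definable_set_subset\<close>)
qed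

lemma dpred_all:
  assumes X: "definable_set M C n X"
    and P: "dpred M C (N + n) (\<lambda>z. P (take N z) (drop N z))"
  shows "dpred M C N (\<lambda>z. \<forall>y \<in> X. P z y)"
proof -
  have "dpred M C N (\<lambda>z. \<not> (\<exists>y \<in> X. \<not> P z y))"
    by (intro dpred_not dpred_ex[OF X] P)
  then show ?thesis
    by simp
qed

lemma definable_eq1: "definable_set M C 2 {[a, a] | a. True}"
  by (rule definable_setI[where as = "[]" and \<phi> = "Eq (Var 0) (Var 1)"])
    (auto simp: formulas_def length_Suc_conv numeral_2_eq_2)

lemma dpred_all_less:
  fixes n :: nat
  shows "(\<And>i. i < n \<Longrightarrow> dpred M C N (P i)) \<Longrightarrow> dpred M C N (\<lambda>z. \<forall>i < n. P i z)"
proof (induct n)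
  case 0
  show ?case by (simp add: dpred_const)
next
  case (Suc n)
  then have "dpred M C N (\<lambda>z. (\<forall>i < n. P i z) \<and> P n z)"
    by (intro dpred_conj) auto
  then show ?case
    by (simp add: All_less_Suc conj_commute)
qed

lemma dpred_eq:
  assumes s: "tuple_term C N s" and t: "tuple_term C N t"
  shows "dpred M C N (\<lambda>z. s z = t z)"
proof -
  obtain n where n: "\<And>z. length z = N \<Longrightarrow> length (s z) = n"
    using s by (auto simp: tuple_term_def tuples_def)
  obtain m where m: "\<And>z. length z = N \<Longrightarrow> length (t z) = m"
    using t by (auto simp: tuple_term_def tuples_def)
  \<comment> \<open>Equality of tuples is a finite conjunction of coordinate equations.
    \<open>take 1 (drop i (s z))\<close> is coordinate \<open>i\<close> kept as a one-element list,
    hence again a tuple term; the constant conjunct \<open>n = m\<close> covers terms of different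
    lengths.\<close>
  have "dpred M C N (\<lambda>z. n = m \<and>
      (\<forall>i < n. take 1 (drop i (s z)) @ take 1 (drop i (t z)) \<in> {[a, a] | a. True}))"
    by (intro dpred_conj dpred_const dpred_all_less dpred_mem[OF definable_eq1]
        tuple_term_append tuple_term_take tuple_term_drop s t)
  then show ?thesis
  proof (rule dpred_cong[THEN iffD1, rotated])
    fix z :: "'a list" assume z: "length z = N"
    show "(n = m \<and> (\<forall>i < n. take 1 (drop i (s z)) @ take 1 (drop i (t z)) \<in> {[a, a] | a. True}))
      \<longleftrightarrow> s z = t z"
      using n[OF z] m[OF z]
      by (auto simp: list_eq_iff_nth_eq[of "s z"] take_Suc hd_drop_conv_nth)
  qed
qed

lemmas dpred_intros = dpred_conj dpred_disj dpred_imp dpred_not dpred_const dpred_eq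
  tuple_term_append tuple_term_take tuple_term_drop tuple_term_id

section \<open>Definable closure and definable maps\<close>

lemma definable_set_mono: "definable_set M C n X \<Longrightarrow> C \<subseteq> D \<Longrightarrow> definable_set M D n X"
  by (elim definable_setE) (rule definable_setI; blast)

lemma definable_singleton:
  assumes "set x \<subseteq> C"
  shows "definable_set M C (length x) {x}"
proof -
  have "dpred M C (length x) (\<lambda>z. z = x)"
    by (intro dpred_eq tuple_term_id tuple_term_const assms)
  moreover have "{z \<in> tuples (length x). z = x} = {x}"
    by (auto simp: tuples_def)
  ultimately show ?thesis
    by (simp add: dpred_def)
qed

lemma subset_dcl: "C \<subseteq> dcl M C"
proof
  fix a assume "a \<in> C"
  then have "definable_set M C (length [a]) {[a]}"
    by (intro definable_singleton) simp
  then show "a \<in> dcl M C"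
    by (simp add: dcl_def)
qed

text \<open>\<open>dcl\<close> is defined for elements only. A tuple is determined by the
  conjunction of the conditions on its coordinates, and each coordinate is a projection of the
  tuple, which carries the notion over to tuples.\<close>

lemma definable_singleton_iff: "definable_set M C (length x) {x} \<longleftrightarrow> set x \<subseteq> dcl M C"
proof
  assume x: "definable_set M C (length x) {x}"
  show "set x \<subseteq> dcl M C"
  proof
    fix a assume "a \<in> set x"
    then obtain i where i: "i < length x" "x ! i = a"
      by (metis in_set_conv_nth)
    have "dpred M C 1 (\<lambda>w. \<exists>z \<in> {x}. w = take 1 (drop i z))"
      by (intro dpred_ex[OF x] dpred_eq tuple_term_take tuple_term_drop tuple_term_id)
    moreover have "{w \<in> tuples 1. \<exists>z \<in> {x}. w = take 1 (drop i z)} = {[a]}"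
      using i by (auto simp: tuples_def take_Suc hd_drop_conv_nth)
    ultimately show "a \<in> dcl M C"
      by (simp add: dpred_def dcl_def)
  qed
next
  assume x: "set x \<subseteq> dcl M C"
  have "definable_set M C 1 {[x ! i]}" if "i < length x" for i
    using x nth_mem[OF that] by (auto simp: dcl_def)
  then have "dpred M C (length x) (\<lambda>z. \<forall>i < length x. take 1 (drop i z) \<in> {[x ! i]})"
    by (intro dpred_all_less dpred_mem tuple_term_take tuple_term_drop tuple_term_id)
  moreover have "{z \<in> tuples (length x). \<forall>i < length x. take 1 (drop i z) \<in> {[x ! i]}} = {x}"
    by (auto simp: tuples_def take_Suc hd_drop_conv_nth intro: nth_equalityI)
  ultimately show "definable_set M C (length x) {x}"
    by (simp add: dpred_def)
qed

text \<open>The entries of \<open>b\<close> are turned back into variables, so that a set definable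
  over \<open>A\<close> and \<open>b\<close> becomes the fibre over \<open>b\<close> of an
  \<open>A\<close>-definable family. The fibre can then be taken over another tuple instead.\<close>

lemma definable_over_tuple:
  assumes "definable_set M (A \<union> set b) k X"
  obtains Y where "definable_set M A (k + length b) Y" "\<forall>u. u \<in> X \<longleftrightarrow> length u = k \<and> u @ b \<in> Y"
proof -
  obtain as \<phi> where 1: "set as \<subseteq> A \<union> set b" "\<phi> \<in> formulas M (k + length as)"
    "\<forall>x. x \<in> X \<longleftrightarrow> length x = k \<and> sat M ((!) (x @ as)) \<phi>"
    by (rule definable_setE[OF assms])
  \<comment> \<open>Parameters outside \<open>A\<close> are entries of \<open>b\<close> and are
    found there, so those in \<open>A\<close> are all that must be kept.\<close>
  define as' where "as' = filter (\<lambda>a. a \<in> A) as"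
  have "set as \<subseteq> set (b @ as')"
    using 1(1) by (auto simp: as'_def)
  from formula_more_params[OF 1(2) this]
  obtain \<psi> where 2: "\<psi> \<in> formulas M (k + length (b @ as'))"
    "\<forall>z. length z = k \<longrightarrow> sat M ((!) (z @ (b @ as'))) \<psi> \<longleftrightarrow> sat M ((!) (z @ as)) \<phi>"
    by blast
  define Y where "Y = {y \<in> tuples (k + length b). sat M ((!) (y @ as')) \<psi>}"
  have "definable_set M A (k + length b) Y"
    by (rule definable_setI[of as' _ \<psi>]) (use 2(1) in \<open>auto simp: Y_def tuples_def as'_def add.assoc\<close>)
  moreover have "u \<in> X \<longleftrightarrow> length u = k \<and> u @ b \<in> Y" for u
    using 1(3)[rule_format, of u] 2(2)[rule_format, of u] by (auto simp: Y_def tuples_def)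
  ultimately show thesis
    using that by blast
qed

lemma definable_over_params:
  assumes "definable_set M C k X"
  obtains as Y where "set as \<subseteq> C" "definable_set M {} (k + length as) Y"
    "\<forall>u. u \<in> X \<longleftrightarrow> length u = k \<and> u @ as \<in> Y"
proof -
  obtain as \<phi> where 1: "set as \<subseteq> C" "\<phi> \<in> formulas M (k + length as)"
    "\<forall>x. x \<in> X \<longleftrightarrow> length x = k \<and> sat M ((!) (x @ as)) \<phi>"
    by (rule definable_setE[OF assms])
  have "definable_set M ({} \<union> set as) k X"
    by (rule definable_setI[OF _ 1(2) 1(3)[rule_format]]) auto
  then obtain Y where "definable_set M {} (k + length as) Y"
    "\<forall>u. u \<in> X \<longleftrightarrow> length u = k \<and> u @ as \<in> Y"
    by (rule definable_over_tuple)
  then show thesis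
    by (rule that[OF 1(1)])
qed

text \<open>A parameter tuple from \<open>dcl M C\<close> is replaced by a variable ranging over its
  singleton, which is definable over \<open>C\<close>. Idempotence of \<open>dcl\<close> rests on
  this.\<close>

lemma definable_set_dcl:
  assumes "definable_set M (dcl M C) k X"
  shows "definable_set M C k X"
proof -
  obtain as Y where 1: "set as \<subseteq> dcl M C" "definable_set M {} (k + length as) Y"
    "\<forall>u. u \<in> X \<longleftrightarrow> length u = k \<and> u @ as \<in> Y"
    by (rule definable_over_params[OF assms])
  have "dpred M C k (\<lambda>z. \<exists>d \<in> {as}. z @ d \<in> Y)"
    using 1(1)
    by (intro dpred_ex[OF iffD2[OF definable_singleton_iff]] dpred_mem[OF definable_set_mono[OF 1(2)]] dpred_intros) auto
  moreover have "{z \<in> tuples k. \<exists>d \<in> {as}. z @ d \<in> Y} = X"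
    using 1(3) by (auto simp: tuples_def)
  ultimately show ?thesis
    by (simp add: dpred_def)
qed

lemma dcl_mono: "C \<subseteq> D \<Longrightarrow> dcl M C \<subseteq> dcl M D"
  unfolding dcl_def by (intro Collect_mono impI) (rule definable_set_mono)

lemma dcl_least: "D \<subseteq> dcl M C \<Longrightarrow> dcl M D \<subseteq> dcl M C"
proof
  fix a assume D: "D \<subseteq> dcl M C" and a: "a \<in> dcl M D"
  from a have "definable_set M D 1 {[a]}"
    by (simp add: dcl_def)
  then have "definable_set M C 1 {[a]}"
    by (rule definable_set_dcl[OF definable_set_mono[OF _ D]])
  then show "a \<in> dcl M C"
    by (simp add: dcl_def)
qed

section \<open>Graphs of definable maps\<close>

definition graph :: "('a list \<Rightarrow> 'a list) \<Rightarrow> 'a list set \<Rightarrow> 'a list set" where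
  "graph f X = {x @ f x | x. x \<in> X}"

lemma append_mem_graph:
  assumes "X \<subseteq> tuples n" "length x = n"
  shows "x @ y \<in> graph f X \<longleftrightarrow> x \<in> X \<and> y = f x"
proof
  assume "x @ y \<in> graph f X"
  then obtain x' where x': "x' \<in> X" "x @ y = x' @ f x'"
    by (auto simp: graph_def)
  moreover have "length x' = n"
    using assms(1) x'(1) by auto
  ultimately show "x \<in> X \<and> y = f x"
    using assms(2) by simp
qed (auto simp: graph_def)

lemma definable_empty: "definable_set M C n {}"
  using dpred_const[of M C n False] by (simp add: dpred_def)

text \<open>The arities in \<open>definable_map\<close> are existentially quantified and are
  determined only by a nonempty domain; the empty set is definable in every arity. The domain itself
  is definable as the projection of the graph.\<close>

lemma definable_mapE:
  assumes "definable_map M C X f" "X \<subseteq> tuples n"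
  obtains m where "f ` X \<subseteq> tuples m" "definable_set M C (n + m) (graph f X)" "definable_set M C n X"
proof (cases "X = {}")
  case True
  then show thesis
    by (intro that[of 0]) (simp_all add: graph_def definable_empty)
next
  case False
  obtain n' m where 1: "X \<subseteq> tuples n'" "f ` X \<subseteq> tuples m" "definable_set M C (n' + m) (graph f X)"
    using assms(1) unfolding definable_map_def graph_def by blast
  have "n' = n"
    using False 1(1) assms(2) by (auto simp: tuples_def)
  note 1 = 1[unfolded this]
  have "dpred M C n (\<lambda>x. \<exists>y \<in> tuples m. x @ y \<in> graph f X)"
    by (intro dpred_ex[OF definable_tuples] dpred_mem[OF 1(3)] dpred_intros)
  moreover have "{x \<in> tuples n. \<exists>y \<in> tuples m. x @ y \<in> graph f X} = X"
  proof (rule Set.set_eqI)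
    fix x
    show "x \<in> {x \<in> tuples n. \<exists>y \<in> tuples m. x @ y \<in> graph f X} \<longleftrightarrow> x \<in> X"
      using 1(1,2) append_mem_graph[OF 1(1), of x _ f] by (auto dest: tuplesD)
  qed
  ultimately show thesis
    using 1 that by (simp add: dpred_def)
qed

lemma definable_mapI:
  assumes "X \<subseteq> tuples n" "f ` X \<subseteq> tuples m" "dpred M C (n + m) P"
    and "\<And>x y. length x = n \<Longrightarrow> length y = m \<Longrightarrow> P (x @ y) \<longleftrightarrow> x \<in> X \<and> y = f x"
  shows "definable_map M C X f"
proof -
  have "{z \<in> tuples (n + m). P z} = {x @ f x | x. x \<in> X}"
  proof (rule Set.set_eqI)
    fix z
    show "z \<in> {z \<in> tuples (n + m). P z} \<longleftrightarrow> z \<in> {x @ f x | x. x \<in> X}"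
    proof
      assume "z \<in> {z \<in> tuples (n + m). P z}"
      then have "length (take n z) = n" "length (drop n z) = m" "P (take n z @ drop n z)"
        by (auto simp: tuples_def)
      then have "take n z \<in> X" "drop n z = f (take n z)"
        using assms(4) by blast+
      then show "z \<in> {x @ f x | x. x \<in> X}"
        by (metis (mono_tags, lifting) append_take_drop_id mem_Collect_eq)
    next
      assume "z \<in> {x @ f x | x. x \<in> X}"
      then obtain x where x: "x \<in> X" "z = x @ f x"
        by blast
      then have "length x = n" "length (f x) = m"
        using assms(1,2) by (auto simp: tuples_def)
      then show "z \<in> {z \<in> tuples (n + m). P z}"
        using x assms(4)[of x "f x"] by (auto simp: tuples_def)
    qed
  qed
  then show ?thesis
    using assms(1,2,3) unfolding definable_map_def dpred_def by auto
qed

lemma definable_image: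
  assumes "definable_map M C X f" "X \<subseteq> tuples n" "definable_set M C n Z" "Z \<subseteq> X"
  shows "\<exists>m. definable_set M C m (f ` Z)"
proof -
  obtain m where 1: "f ` X \<subseteq> tuples m" "definable_set M C (n + m) (graph f X)"
    by (rule definable_mapE[OF assms(1,2)])
  have "dpred M C m (\<lambda>y. \<exists>x \<in> Z. x @ y \<in> graph f X)"
    by (intro dpred_ex[OF assms(3)] dpred_mem[OF 1(2)] dpred_intros)
  moreover have "{y \<in> tuples m. \<exists>x \<in> Z. x @ y \<in> graph f X} = f ` Z"
  proof -
    have "x @ y \<in> graph f X \<longleftrightarrow> y = f x" if "x \<in> Z" for x y
      using append_mem_graph[OF assms(2)] that assms(4) definable_set_length[OF assms(3) that] by blast
    then show ?thesis
      using 1(1) assms(4) by (auto simp: image_subset_iff subset_iff)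
  qed
  ultimately show ?thesis
    by (auto simp: dpred_def)
qed

lemma definable_map_comp:
  assumes f: "definable_map M C X f" and g: "definable_map M C Y g" and "f ` X \<subseteq> Y"
  shows "definable_map M C X (\<lambda>x. g (f x))"
proof -
  obtain n where n: "X \<subseteq> tuples n"
    using f by (auto simp: definable_map_def)
  obtain m where m: "Y \<subseteq> tuples m"
    using g by (auto simp: definable_map_def)
  obtain m' where 1: "definable_set M C (n + m') (graph f X)" "definable_set M C n X"
    by (rule definable_mapE[OF f n])
  obtain k where 2: "g ` Y \<subseteq> tuples k" "definable_set M C (m + k) (graph g Y)" "definable_set M C m Y"
    by (rule definable_mapE[OF g m])
  show ?thesis
  proof (rule definable_mapI[OF n])
    show "(\<lambda>x. g (f x)) ` X \<subseteq> tuples k"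
      using assms(3) 2(1) by blast
    show "dpred M C (n + k) (\<lambda>z. \<exists>y \<in> Y. take n z @ y \<in> graph f X \<and> y @ drop n z \<in> graph g Y)"
      by (intro dpred_ex[OF 2(3)] dpred_mem[OF 1(1)] dpred_mem[OF 2(2)] dpred_intros)
    fix x z :: "'c list" assume "length x = n" "length z = k"
    moreover have "y @ z \<in> graph g Y \<longleftrightarrow> z = g y" if "y \<in> Y" for y
      using append_mem_graph[OF m] that m by blast
    ultimately show "(\<exists>y \<in> Y. take n (x @ z) @ y \<in> graph f X \<and> y @ drop n (x @ z) \<in> graph g Y) \<longleftrightarrow>
        x \<in> X \<and> z = g (f x)"
      using append_mem_graph[OF n] assms(3) by auto
  qed
qed

lemma definable_map_inv:
  assumes f: "definable_map M C X f" and bij: "bij_betw f X Y"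
  shows "definable_map M C Y (the_inv_into X f)"
proof -
  obtain n where n: "X \<subseteq> tuples n"
    using f by (auto simp: definable_map_def)
  obtain m where 1: "f ` X \<subseteq> tuples m" "definable_set M C (n + m) (graph f X)"
    by (rule definable_mapE[OF f n])
  have inj: "inj_on f X" and Y: "f ` X = Y"
    using bij by (auto simp: bij_betw_def)
  show ?thesis
  proof (rule definable_mapI)
    show "Y \<subseteq> tuples m"
      using 1(1) Y by blast
    show "the_inv_into X f ` Y \<subseteq> tuples n"
      using the_inv_into_onto[OF inj] n Y by blast
    show "dpred M C (m + n) (\<lambda>z. drop m z @ take m z \<in> graph f X)"
      by (intro dpred_mem[OF 1(2)] dpred_intros)
    fix y x :: "'c list" assume "length y = m" "length x = n"
    then have "drop m (y @ x) @ take m (y @ x) \<in> graph f X \<longleftrightarrow> x \<in> X \<and> y = f x"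
      using append_mem_graph[OF n] by simp
    also have "\<dots> \<longleftrightarrow> y \<in> Y \<and> x = the_inv_into X f y"
    proof
      assume "x \<in> X \<and> y = f x"
      then show "y \<in> Y \<and> x = the_inv_into X f y"
        using Y by (auto simp: the_inv_into_f_f[OF inj])
    next
      assume "y \<in> Y \<and> x = the_inv_into X f y"
      then show "x \<in> X \<and> y = f x"
        using Y f_the_inv_into_f[OF inj, of y] the_inv_into_into[OF inj, of y X] by simp
    qed
    finally show "drop m (y @ x) @ take m (y @ x) \<in> graph f X \<longleftrightarrow> y \<in> Y \<and> x = the_inv_into X f y" .
  qed
qed

lemma definable_map_dcl:
  assumes f: "definable_map M C X f" and x: "x \<in> X"
  shows "set (f x) \<subseteq> dcl M (C \<union> set x)"
proof -
  obtain n where n: "X \<subseteq> tuples n"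
    using f by (auto simp: definable_map_def)
  obtain m where 1: "f ` X \<subseteq> tuples m" "definable_set M C (n + m) (graph f X)"
    by (rule definable_mapE[OF f n])
  have "dpred M (C \<union> set x) m (\<lambda>y. x @ y \<in> graph f X)"
    by (intro dpred_mem[OF definable_set_mono[OF 1(2)]] dpred_intros tuple_term_const) auto
  moreover have "{y \<in> tuples m. x @ y \<in> graph f X} = {f x}"
    using append_mem_graph[OF n, of x _ f] n 1(1) x by (auto simp: tuples_def)
  moreover have "length (f x) = m"
    using 1(1) x by auto
  ultimately show ?thesis
    unfolding definable_singleton_iff[symmetric] by (simp add: dpred_def)
qed

text \<open>\<open>x\<close> and \<open>f x\<close> are interdefinable, since \<open>x\<close> is
  the value at \<open>f x\<close> of the inverse map, which is definable too. In this way generators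
  of \<open>B\<close> are moved from \<open>Q\<close> into \<open>W\<close> or
  \<open>G\<close>.\<close>

lemma dcl_definable_inj:
  assumes f: "definable_map M C X f" and "inj_on f X" and x: "x \<in> X"
  shows "dcl M (C \<union> set (f x)) = dcl M (C \<union> set x)"
proof
  have C: "C \<subseteq> dcl M (C \<union> D)" for D
    by (rule order_trans[OF Un_upper1 subset_dcl])
  have "set (the_inv_into X f (f x)) \<subseteq> dcl M (C \<union> set (f x))"
    by (rule definable_map_dcl[OF definable_map_inv[OF f]])
      (use assms in \<open>auto simp: bij_betw_def\<close>)
  then have "set x \<subseteq> dcl M (C \<union> set (f x))"
    using the_inv_into_f_f[OF assms(2) x] by simp
  then show "dcl M (C \<union> set x) \<subseteq> dcl M (C \<union> set (f x))"
    by (intro dcl_least Un_least C)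
  show "dcl M (C \<union> set (f x)) \<subseteq> dcl M (C \<union> set x)"
    by (intro dcl_least Un_least C definable_map_dcl[OF f x])
qed

section \<open>Definable quotients\<close>

lemma append_mem_pairs:
  assumes "\<And>x y. P x y \<Longrightarrow> length x = n" and "length x = n"
  shows "x @ y \<in> {x @ y | x y. P x y} \<longleftrightarrow> P x y"
proof
  assume "x @ y \<in> {x @ y | x y. P x y}"
  then obtain x' y' where "x @ y = x' @ y'" "P x' y'"
    by blast
  moreover from this(2) have "length x' = n"
    by (rule assms(1))
  ultimately show "P x y"
    using assms(2) by simp
qed blast

text \<open>\<open>P\<close> is the form of \<open>R\<close> that is visibly given by a formula. The
  two are compared only on \<open>X\<close> and \<open>Y\<close>, where lengths are known and group
  or torsor laws are available.\<close>

lemma definable_pairs: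
  assumes X: "definable_set M C n X" and Y: "definable_set M C m Y"
    and P: "dpred M C (n + m) (\<lambda>z. P (take n z) (drop n z))"
    and iff: "\<And>x y. x \<in> X \<Longrightarrow> y \<in> Y \<Longrightarrow> P x y \<longleftrightarrow> R x y"
  shows "definable_set M C (n + m) {x @ y | x y. x \<in> X \<and> y \<in> Y \<and> R x y}"
proof -
  have "dpred M C (n + m) (\<lambda>z. take n z \<in> X \<and> drop n z \<in> Y \<and> P (take n z) (drop n z))"
    by (intro dpred_conj P dpred_mem[OF X] dpred_mem[OF Y] dpred_intros)
  moreover have "{z \<in> tuples (n + m). take n z \<in> X \<and> drop n z \<in> Y \<and> P (take n z) (drop n z)} =
      {x @ y | x y. x \<in> X \<and> y \<in> Y \<and> R x y}" (is "?L = ?R")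
  proof (intro subset_antisym subsetI)
    fix z assume "z \<in> ?L"
    then show "z \<in> ?R"
      using iff by (metis (mono_tags, lifting) append_take_drop_id mem_Collect_eq)
  next
    fix z assume "z \<in> ?R"
    then obtain x y where "z = x @ y" "x \<in> X" "y \<in> Y" "R x y"
      by blast
    moreover have "length x = n" "length y = m"
      using X Y \<open>x \<in> X\<close> \<open>y \<in> Y\<close> by (simp_all add: definable_set_length)
    ultimately show "z \<in> ?L"
      using iff by (simp add: tuples_def)
  qed
  ultimately show ?thesis
    by (simp add: dpred_def)
qed

lemma definable_prod:
  assumes "definable_set M C n X" "definable_set M C m Y"
  shows "definable_set M C (n + m) {x @ y | x y. x \<in> X \<and> y \<in> Y}"
proof -
  have "dpred M C (n + m) (\<lambda>z. True)"
    by (rule dpred_const)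
  from definable_pairs[OF assms this, of "\<lambda>_ _. True"] show ?thesis
    by simp
qed

lemma definable_triples:
  assumes X: "definable_set M C n X" and Y: "definable_set M C m Y" and Z: "definable_set M C k Z"
    and P: "dpred M C (n + m + k) (\<lambda>z. P (take n z) (take m (drop n z)) (drop (n + m) z))"
    and iff: "\<And>x y w. x \<in> X \<Longrightarrow> y \<in> Y \<Longrightarrow> w \<in> Z \<Longrightarrow> P x y w \<longleftrightarrow> R x y w"
  shows "definable_set M C (n + m + k) {x @ y @ w | x y w. x \<in> X \<and> y \<in> Y \<and> w \<in> Z \<and> R x y w}"
proof -
  let ?R = "\<lambda>u w. R (take n u) (drop n u) w"
  have len: "length x = n" if "x \<in> X" for x
    using definable_set_length[OF X that] .
  have "definable_set M C (n + m + k)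
      {u @ w | u w. u \<in> {x @ y | x y. x \<in> X \<and> y \<in> Y} \<and> w \<in> Z \<and> ?R u w}"
  proof (rule definable_pairs[OF definable_prod[OF X Y] Z, where P = "\<lambda>u w. P (take n u) (drop n u) w"])
    show "dpred M C (n + m + k) (\<lambda>z. P (take n (take (n + m) z)) (drop n (take (n + m) z)) (drop (n + m) z))"
      using P by (simp add: drop_take min_def)
  qed (use iff len in auto)
  also have "{u @ w | u w. u \<in> {x @ y | x y. x \<in> X \<and> y \<in> Y} \<and> w \<in> Z \<and> ?R u w} =
      {x @ y @ w | x y w. x \<in> X \<and> y \<in> Y \<and> w \<in> Z \<and> R x y w}" (is "?A = ?B")
  proof (intro subset_antisym subsetI)
    fix z assume "z \<in> ?A"
    then obtain x y w where "z = (x @ y) @ w" "x \<in> X" "y \<in> Y" "w \<in> Z" "?R (x @ y) w"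
      by blast
    then show "z \<in> ?B"
      using len[of x] by auto
  next
    fix z assume "z \<in> ?B"
    then obtain x y w where z: "z = (x @ y) @ w" "x \<in> X" "y \<in> Y" "w \<in> Z" "R x y w"
      by auto
    then have "?R (x @ y) w"
      using len[of x] by simp
    then show "z \<in> ?A"
      using z by blast
  qed
  finally show ?thesis .
qed

text \<open>For a parameter tuple outside \<open>good\<close> the extended relation is equality, so that it is a
  0-definable equivalence relation whatever the formula says there.\<close>

lemma quotient_map_exists:
  assumes EI: "eliminates_imaginaries M"
    and S: "definable_set M A n S"
    and E: "definable_set M A (n + n) {x @ y | x y. x \<in> S \<and> y \<in> S \<and> R x y}"
    and refl: "\<And>x. x \<in> S \<Longrightarrow> R x x"
    and sym: "\<And>x y. x \<in> S \<Longrightarrow> y \<in> S \<Longrightarrow> R x y \<Longrightarrow> R y x"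
    and trans: "\<And>x y z. x \<in> S \<Longrightarrow> y \<in> S \<Longrightarrow> z \<in> S \<Longrightarrow> R x y \<Longrightarrow> R y z \<Longrightarrow> R x z"
  shows "\<exists>\<pi>. quotient_map M A S R \<pi>"
proof -
  obtain as Y where as: "set as \<subseteq> A" and Y: "definable_set M {} (n + n + length as) Y"
    and EY: "\<forall>u. u \<in> {x @ y | x y. x \<in> S \<and> y \<in> S \<and> R x y} \<longleftrightarrow> length u = n + n \<and> u @ as \<in> Y"
    by (rule definable_over_params[OF E])
  define k where "k = length as"
  have lenS: "length x = n" if "x \<in> S" for x
    using definable_set_length[OF S that] .
  define Q where "Q d x y \<longleftrightarrow> x @ y @ d \<in> Y" for d x y
  have Q_as: "Q as x y \<longleftrightarrow> x \<in> S \<and> y \<in> S \<and> R x y" if "length x = n" "length y = n" for x y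
  proof -
    have "Q as x y \<longleftrightarrow> x @ y \<in> {x @ y | x y. x \<in> S \<and> y \<in> S \<and> R x y}"
      using EY that by (simp add: Q_def)
    also have "\<dots> \<longleftrightarrow> x \<in> S \<and> y \<in> S \<and> R x y"
      by (rule append_mem_pairs[where P = "\<lambda>x y. x \<in> S \<and> y \<in> S \<and> R x y", OF _ that(1)])
        (simp add: lenS)
    finally show ?thesis .
  qed
  \<comment> \<open>Being good is a parameter-free condition on \<open>d\<close>. Reflexivity is
    left out of it because \<open>F\<close> contains the disjunct \<open>u = v\<close>; for
    \<open>d = as\<close> the points outside \<open>S\<close> thus form classes of their
    own.\<close>
  define good where "good d \<longleftrightarrow> (\<forall>x \<in> tuples n. \<forall>y \<in> tuples n. Q d x y \<longrightarrow> Q d y x) \<and>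
    (\<forall>x \<in> tuples n. \<forall>y \<in> tuples n. \<forall>z \<in> tuples n. Q d x y \<longrightarrow> Q d y z \<longrightarrow> Q d x z)" for d
  have good_as: "good as"
    unfolding good_def
  proof (intro conjI ballI impI)
    fix x y assume "x \<in> tuples n" "y \<in> tuples n" "Q as x y"
    then show "Q as y x"
      using Q_as[of x y] Q_as[of y x] sym[of x y] by (auto dest!: tuplesD)
  next
    fix x y z assume "x \<in> tuples n" "y \<in> tuples n" "z \<in> tuples n" "Q as x y" "Q as y z"
    then show "Q as x z"
      using Q_as[of x y] Q_as[of y z] Q_as[of x z] trans[of x y z] by (auto dest!: tuplesD)
  qed
  \<comment> \<open>The parameter tuple travels with the point as its last \<open>k\<close>
    coordinates, and only points carrying the same parameters can be identified.\<close>
  define F where "F u v \<longleftrightarrow> u = v \<or>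
    drop n u = drop n v \<and> good (drop n u) \<and> Q (drop n u) (take n u) (take n v)" for u v
  define E' where "E' = {(u, v). u \<in> tuples (n + k) \<and> v \<in> tuples (n + k) \<and> F u v}"
  have take: "take n u \<in> tuples n" if "u \<in> tuples (n + k)" for u :: "'c list"
    using that by (simp add: tuples_def)
  have good_sym: "Q d y x" if "good d" "x \<in> tuples n" "y \<in> tuples n" "Q d x y" for d x y
    using that unfolding good_def by blast
  have good_trans: "Q d x z"
    if "good d" "x \<in> tuples n" "y \<in> tuples n" "z \<in> tuples n" "Q d x y" "Q d y z" for d x y z
    using that(1) unfolding good_def using that(2-) by blast
  have F_sym: "F v u" if "u \<in> tuples (n + k)" "v \<in> tuples (n + k)" "F u v" for u v
    using that(3) good_sym[OF _ take[OF that(1)] take[OF that(2)]] unfolding F_def by auto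
  have F_trans: "F u w"
    if "u \<in> tuples (n + k)" "v \<in> tuples (n + k)" "w \<in> tuples (n + k)" "F u v" "F v w" for u v w
    using that(4,5) good_trans[OF _ take[OF that(1)] take[OF that(2)] take[OF that(3)]]
    unfolding F_def by auto
  have "equiv (tuples (n + k)) E'"
  proof (rule equivI)
    show "E' \<subseteq> tuples (n + k) \<times> tuples (n + k)"
      by (auto simp: E'_def)
    show "refl_on (tuples (n + k)) E'"
      by (auto simp: refl_on_def E'_def F_def)
    show "sym_on UNIV E'"
      using F_sym by (auto simp: sym_on_def E'_def)
    show "trans_on UNIV E'"
      unfolding trans_on_def E'_def using F_trans by blast
  qed
  moreover have "definable_set M {} ((n + k) + (n + k)) {x @ y | x y. (x, y) \<in> E'}"
  proof -
    note ex = dpred_all[OF definable_tuples] dpred_mem[OF Y[folded k_def]] dpred_intros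
    have "dpred M {} ((n + k) + (n + k)) (\<lambda>z. F (take (n + k) z) (drop (n + k) z))"
      unfolding F_def good_def Q_def by (intro ex)
    from definable_pairs[OF definable_tuples definable_tuples this]
    show ?thesis
      by (auto simp: E'_def conj_assoc elim!: back_subst[of "definable_set M {} _"])
  qed
  ultimately obtain f where f: "definable_map M {} (tuples (n + k)) f"
    "\<forall>x \<in> tuples (n + k). \<forall>y \<in> tuples (n + k). f x = f y \<longleftrightarrow> (x, y) \<in> E'"
    using EI unfolding eliminates_imaginaries_def by blast
  obtain m where m: "f ` tuples (n + k) \<subseteq> tuples m"
      "definable_set M {} (n + k + m) (graph f (tuples (n + k)))"
    by (rule definable_mapE[OF f(1) order_refl])
  \<comment> \<open>Freezing the last coordinates at \<open>as\<close> costs only parameters from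
    \<open>A\<close>. As \<open>as\<close> is good, \<open>F\<close> between two points of
    \<open>S\<close> extended by \<open>as\<close> is \<open>R\<close>.\<close>
  define \<pi> where "\<pi> x = f (x @ as)" for x
  have tup: "x @ as \<in> tuples (n + k)" if "length x = n" for x
    using that by (simp add: tuples_def k_def)
  have "definable_map M A S \<pi>"
  proof (rule definable_mapI)
    show "S \<subseteq> tuples n"
      by (rule definable_set_subset[OF S])
    show "\<pi> ` S \<subseteq> tuples m"
      using m(1) tup lenS by (auto simp: \<pi>_def)
    show "dpred M A (n + m) (\<lambda>z. take n z \<in> S \<and>
        (take n z @ as) @ drop n z \<in> graph f (tuples (n + k)))"
      by (intro dpred_conj dpred_mem[OF S] dpred_mem[OF definable_set_mono[OF m(2) empty_subsetI]]
          dpred_intros tuple_term_const as)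
    fix x y :: "'c list" assume "length x = n" "length y = m"
    then show "take n (x @ y) \<in> S \<and>
        (take n (x @ y) @ as) @ drop n (x @ y) \<in> graph f (tuples (n + k)) \<longleftrightarrow> x \<in> S \<and> y = \<pi> x"
      using append_mem_graph[of "tuples (n + k)" "n + k" "x @ as" y f] tup[of x]
      by (simp add: \<pi>_def k_def)
  qed
  moreover have "\<pi> x = \<pi> y \<longleftrightarrow> R x y" if "x \<in> S" "y \<in> S" for x y
  proof -
    have "\<pi> x = \<pi> y \<longleftrightarrow> F (x @ as) (y @ as)"
      using f(2) tup lenS that by (simp add: \<pi>_def E'_def)
    also have "\<dots> \<longleftrightarrow> R x y"
      using lenS that good_as Q_as[of x y] refl by (auto simp: F_def)
    finally show ?thesis .
  qed
  ultimately show ?thesis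
    unfolding quotient_map_def by blast
qed

section \<open>The torsor induced along a subgroup\<close>

lemma append_mem_triples:
  assumes "X \<subseteq> tuples n" "Y \<subseteq> tuples m" "x \<in> X" "y \<in> Y"
  shows "x @ y @ w \<in> {x @ y @ f x y | x y. x \<in> X \<and> y \<in> Y} \<longleftrightarrow> w = f x y"
proof
  assume "x @ y @ w \<in> {x @ y @ f x y | x y. x \<in> X \<and> y \<in> Y}"
  then obtain x' y' where 1: "x @ y @ w = x' @ y' @ f x' y'" "x' \<in> X" "y' \<in> Y"
    by blast
  have "length x' = length x" "length y' = length y"
    using assms 1(2,3) by (auto simp: tuples_def)
  with 1(1) show "w = f x y"
    by simp
next
  assume "w = f x y"
  with assms(3,4) show "x @ y @ w \<in> {x @ y @ f x y | x y. x \<in> X \<and> y \<in> Y}"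
    by blast
qed

lemma definable_map_graph:
  assumes "definable_map M C X f" "X \<subseteq> tuples n" "f ` X \<subseteq> tuples m"
  shows "definable_set M C (n + m) (graph f X)"
proof (cases "X = {}")
  case True
  then show ?thesis
    by (simp add: graph_def definable_empty)
next
  case False
  obtain m' where m': "f ` X \<subseteq> tuples m'" "definable_set M C (n + m') (graph f X)"
    by (rule definable_mapE[OF assms(1,2)])
  have "m' = m"
    using False assms(3) m'(1) by (auto simp: tuples_def)
  with m'(2) show ?thesis
    by simp
qed

text \<open>A torsor for the subgroup \<open>H\<close> of \<open>G\<close>, its axioms written with the operations of \<open>G\<close>.\<close>

locale subgroup_torsor = group G for G :: "'a list monoid" (structure) +
  fixes M :: "('f, 'r, 'a) struct" and A :: "'a set" and H :: "'a list monoid"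
    and V :: "'a list set" and act :: "'a list \<Rightarrow> 'a list \<Rightarrow> 'a list" and n m :: nat
  assumes sub: "subgroup (carrier H) G"
    and defG: "definable_set M A m (carrier G)"
    and def_mult: "definable_set M A (m + m + m)
          {x @ y @ (x \<otimes> y) | x y. x \<in> carrier G \<and> y \<in> carrier G}"
    and defH: "definable_set M A m (carrier H)"
    and defV: "definable_set M A n V"
    and def_act: "definable_set M A (n + m + n) {v @ h @ act v h | v h. v \<in> V \<and> h \<in> carrier H}"
    and nonempty: "V \<noteq> {}"
    and act_closed: "\<And>v h. v \<in> V \<Longrightarrow> h \<in> carrier H \<Longrightarrow> act v h \<in> V"
    and act_one: "\<And>v. v \<in> V \<Longrightarrow> act v \<one> = v"
    and act_act: "\<And>v g h. v \<in> V \<Longrightarrow> g \<in> carrier H \<Longrightarrow> h \<in> carrier H \<Longrightarrow>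
          act (act v g) h = act v (g \<otimes> h)"
    and act_ex1: "\<And>v w. v \<in> V \<Longrightarrow> w \<in> V \<Longrightarrow> \<exists>!h. h \<in> carrier H \<and> act v h = w"
begin

lemma H_G [simp]: "h \<in> carrier H \<Longrightarrow> h \<in> carrier G"
  using sub by (rule subgroup.mem_carrier)

lemma H_mult [simp]: "g \<in> carrier H \<Longrightarrow> h \<in> carrier H \<Longrightarrow> g \<otimes> h \<in> carrier H"
  using sub by (rule subgroup.m_closed)

lemma H_one [simp]: "\<one> \<in> carrier H"
  using sub by (rule subgroup.one_closed)

lemma H_inv [simp]: "h \<in> carrier H \<Longrightarrow> inv h \<in> carrier H"
  using sub by (rule subgroup.m_inv_closed)

lemma length_V: "v \<in> V \<Longrightarrow> length v = n"
  using defV by (rule definable_set_length)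

lemma length_G: "g \<in> carrier G \<Longrightarrow> length g = m"
  using defG by (rule definable_set_length)

lemma act_trivial: "v \<in> V \<Longrightarrow> h \<in> carrier H \<Longrightarrow> act v h = v \<Longrightarrow> h = \<one>"
  using act_ex1[of v v] act_one[of v] H_one by blast

definition act_graph where
  "act_graph = {v @ h @ act v h | v h. v \<in> V \<and> h \<in> carrier H}"

definition mult_graph where
  "mult_graph = {x @ y @ (x \<otimes> y) | x y. x \<in> carrier G \<and> y \<in> carrier G}"

lemma mem_act_graph: "v \<in> V \<Longrightarrow> h \<in> carrier H \<Longrightarrow> v @ h @ w \<in> act_graph \<longleftrightarrow> w = act v h"
  unfolding act_graph_def
  by (rule append_mem_triples[OF definable_set_subset[OF defV] definable_set_subset[OF defH]])

lemma mem_mult_graph: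
  "x \<in> carrier G \<Longrightarrow> y \<in> carrier G \<Longrightarrow> x @ y @ w \<in> mult_graph \<longleftrightarrow> w = x \<otimes> y"
  unfolding mult_graph_def
  by (rule append_mem_triples[OF definable_set_subset[OF defG] definable_set_subset[OF defG]])

lemmas def_act_graph = def_act[folded act_graph_def]
lemmas def_mult_graph = def_mult[folded mult_graph_def]

definition pairs where "pairs = {v @ g | v g. v \<in> V \<and> g \<in> carrier G}"

text \<open>The form is the one in \<open>induced_torsor\<close>, so that the two can be matched by
  unfolding. Computations use \<open>rel_append\<close>, where the fixed length of points of
  \<open>V\<close> makes the splitting into pairs unique.\<close>

definition rel where
  "rel x y \<longleftrightarrow> (\<exists>v1 \<in> V. \<exists>g1 \<in> carrier G. \<exists>v2 \<in> V. \<exists>g2 \<in> carrier G. x = v1 @ g1 \<and> y = v2 @ g2 \<and>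
    (\<exists>h \<in> carrier H. v2 = act v1 h \<and> g1 = h \<otimes> g2))"

lemma def_pairs: "definable_set M A (n + m) pairs"
  unfolding pairs_def by (rule definable_prod[OF defV defG])

lemma pairsE:
  assumes "x \<in> pairs"
  obtains v g where "v \<in> V" "g \<in> carrier G" "x = v @ g"
  using assms unfolding pairs_def by blast

lemma pairsI: "v \<in> V \<Longrightarrow> g \<in> carrier G \<Longrightarrow> v @ g \<in> pairs"
  unfolding pairs_def by blast

lemma rel_append:
  assumes "v \<in> V" "v' \<in> V" "g \<in> carrier G" "g' \<in> carrier G"
  shows "rel (v @ g) (v' @ g') \<longleftrightarrow> (\<exists>h \<in> carrier H. v' = act v h \<and> g = h \<otimes> g')"
proof
  assume "rel (v @ g) (v' @ g')"
  then obtain v1 g1 v2 g2 h where 1: "v1 \<in> V" "v2 \<in> V" "v @ g = v1 @ g1" "v' @ g' = v2 @ g2"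
    "h \<in> carrier H" "v2 = act v1 h" "g1 = h \<otimes> g2"
    unfolding rel_def by blast
  moreover have "v = v1 \<and> g = g1"
    using 1(3) length_V[OF 1(1)] length_V[OF assms(1)] by simp
  moreover have "v' = v2 \<and> g' = g2"
    using 1(4) length_V[OF 1(2)] length_V[OF assms(2)] by simp
  ultimately show "\<exists>h \<in> carrier H. v' = act v h \<and> g = h \<otimes> g'"
    by blast
next
  assume "\<exists>h \<in> carrier H. v' = act v h \<and> g = h \<otimes> g'"
  with assms show "rel (v @ g) (v' @ g')"
    unfolding rel_def by blast
qed

lemma def_rel:
  "definable_set M A ((n + m) + (n + m)) {x @ y | x y. x \<in> pairs \<and> y \<in> pairs \<and> rel x y}"
proof (rule definable_pairs[OF def_pairs def_pairs])
  show "dpred M A ((n + m) + (n + m)) (\<lambda>z. \<exists>h \<in> carrier H.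
      take n (take (n + m) z) @ h @ take n (drop (n + m) z) \<in> act_graph \<and>
      h @ drop n (drop (n + m) z) @ drop n (take (n + m) z) \<in> mult_graph)"
    by (intro dpred_ex[OF defH] dpred_mem[OF def_act_graph] dpred_mem[OF def_mult_graph] dpred_intros)
  fix x y assume "x \<in> pairs" "y \<in> pairs"
  then obtain v g v' g' where 1: "v \<in> V" "g \<in> carrier G" "v' \<in> V" "g' \<in> carrier G"
    and 2: "x = v @ g" "y = v' @ g'"
    by (elim pairsE)
  show "(\<exists>h \<in> carrier H. take n x @ h @ take n y \<in> act_graph \<and> h @ drop n y @ drop n x \<in> mult_graph)
      \<longleftrightarrow> rel x y"
    using 1 unfolding 2 rel_append[OF 1(1,3,2,4)]
    by (intro bex_cong refl) (simp add: length_V mem_act_graph mem_mult_graph)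
qed

lemma quotient_exists:
  assumes "eliminates_imaginaries M"
  shows "\<exists>\<pi>. quotient_map M A pairs rel \<pi>"
proof (rule quotient_map_exists[OF assms def_pairs def_rel])
  fix x assume "x \<in> pairs"
  then obtain v g where 1: "v \<in> V" "g \<in> carrier G" and x: "x = v @ g"
    by (rule pairsE)
  show "rel x x"
    unfolding x rel_append[OF 1(1,1,2,2)]
    by (intro bexI[of _ \<one>]) (simp_all add: 1 act_one)
next
  fix x y assume "x \<in> pairs" "y \<in> pairs" and r: "rel x y"
  then obtain v g v' g' where 1: "v \<in> V" "g \<in> carrier G" "v' \<in> V" "g' \<in> carrier G"
    and 2: "x = v @ g" "y = v' @ g'"
    by (elim pairsE)
  obtain h where h: "h \<in> carrier H" "v' = act v h" "g = h \<otimes> g'"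
    using r unfolding 2 rel_append[OF 1(1,3,2,4)] by blast
  show "rel y x"
    unfolding 2 rel_append[OF 1(3,1,4,2)]
    using h 1 by (intro bexI[of _ "inv h"]) (simp_all add: act_act act_one m_assoc[symmetric])
next
  fix x y z assume "x \<in> pairs" "y \<in> pairs" "z \<in> pairs" and r: "rel x y" "rel y z"
  then obtain v g v' g' v'' g'' where 1: "v \<in> V" "g \<in> carrier G" "v' \<in> V" "g' \<in> carrier G"
    "v'' \<in> V" "g'' \<in> carrier G" and 2: "x = v @ g" "y = v' @ g'" "z = v'' @ g''"
    by (elim pairsE)
  obtain h where h: "h \<in> carrier H" "v' = act v h" "g = h \<otimes> g'"
    using r(1) unfolding 2 rel_append[OF 1(1,3,2,4)] by blast
  obtain k where k: "k \<in> carrier H" "v'' = act v' k" "g' = k \<otimes> g''"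
    using r(2) unfolding 2 rel_append[OF 1(3,5,4,6)] by blast
  show "rel x z"
    unfolding 2 rel_append[OF 1(1,5,2,6)]
    using h k 1 by (intro bexI[of _ "h \<otimes> k"]) (simp_all add: act_act m_assoc)
qed

end

text \<open>An arbitrary realization of the induced torsor: \<open>induced_torsor\<close> prescribes
  neither the quotient map nor the values of \<open>actW\<close> off its domain, and
  \<open>iota1\<close> ranges over all of them.\<close>

locale induced = subgroup_torsor +
  fixes \<pi> :: "'a list \<Rightarrow> 'a list" and W :: "'a list set" and actW :: "'a list \<Rightarrow> 'a list \<Rightarrow> 'a list"
  assumes quot: "quotient_map M A pairs rel \<pi>"
    and W: "W = {\<pi> (v @ g) | v g. v \<in> V \<and> g \<in> carrier G}"
    and actW: "\<And>v g g'. v \<in> V \<Longrightarrow> g \<in> carrier G \<Longrightarrow> g' \<in> carrier G \<Longrightarrow>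
          actW (\<pi> (v @ g)) g' = \<pi> (v @ (g \<otimes> g'))"
begin

lemma WE:
  assumes "w \<in> W"
  obtains v g where "v \<in> V" "g \<in> carrier G" "w = \<pi> (v @ g)"
  using assms unfolding W by blast

lemma WI: "v \<in> V \<Longrightarrow> g \<in> carrier G \<Longrightarrow> \<pi> (v @ g) \<in> W"
  unfolding W by blast

lemma W_image: "W = \<pi> ` pairs"
  unfolding W pairs_def by blast

lemma def_pi: "definable_map M A pairs \<pi>"
  using quot unfolding quotient_map_def by blast

lemma pi_eq:
  assumes "v \<in> V" "v' \<in> V" "g \<in> carrier G" "g' \<in> carrier G"
  shows "\<pi> (v @ g) = \<pi> (v' @ g') \<longleftrightarrow> (\<exists>h \<in> carrier H. v' = act v h \<and> g = h \<otimes> g')"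
proof -
  have "\<pi> (v @ g) = \<pi> (v' @ g') \<longleftrightarrow> rel (v @ g) (v' @ g')"
    using quot pairsI assms unfolding quotient_map_def by blast
  then show ?thesis
    by (simp add: rel_append assms)
qed

lemma pi_act:
  assumes "v \<in> V" "h \<in> carrier H" "g \<in> carrier G"
  shows "\<pi> (act v h @ g) = \<pi> (v @ (h \<otimes> g))"
proof -
  have "\<pi> (v @ (h \<otimes> g)) = \<pi> (act v h @ g)"
    using assms by (subst pi_eq) (auto simp: act_closed)
  then show ?thesis by simp
qed

lemma pi_eq_same:
  assumes "v \<in> V" "g \<in> carrier G" "g' \<in> carrier G"
  shows "\<pi> (v @ g) = \<pi> (v @ g') \<longleftrightarrow> g = g'"
proof
  assume "\<pi> (v @ g) = \<pi> (v @ g')"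
  then obtain h where "h \<in> carrier H" "v = act v h" "g = h \<otimes> g'"
    using assms by (auto simp: pi_eq)
  then show "g = g'"
    using act_trivial[of v h] assms by simp
qed simp

text \<open>By transitivity of \<open>H\<close> on \<open>V\<close>, all points of \<open>W\<close>
  can be written over one chosen \<open>v\<close>, and by \<open>pi_eq_same\<close> uniquely so.
  This identifies \<open>W\<close> with \<open>G\<close>, depending on \<open>v\<close>, and turns
  statements about \<open>W\<close> into equations in \<open>G\<close>.\<close>

lemma W_common:
  assumes "w \<in> W" "v \<in> V"
  obtains g where "g \<in> carrier G" "w = \<pi> (v @ g)"
proof -
  obtain v' g where 1: "v' \<in> V" "g \<in> carrier G" "w = \<pi> (v' @ g)"
    using assms(1) by (rule WE)
  obtain h where "h \<in> carrier H" "v' = act v h"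
    using act_ex1[OF assms(2) 1(1)] by blast
  with 1 assms(2) show thesis
    by (intro that[of "h \<otimes> g"]) (simp_all add: pi_act)
qed

lemma actW_closed: "w \<in> W \<Longrightarrow> g \<in> carrier G \<Longrightarrow> actW w g \<in> W"
  by (erule WE) (simp add: actW WI)

lemma right_torsor_W: "right_torsor G W actW"
proof -
  have one: "actW w \<one> = w" if "w \<in> W" for w
    using that by (rule WE) (simp add: actW)
  have assoc: "actW (actW w g) h = actW w (g \<otimes> h)"
    if "w \<in> W" "g \<in> carrier G" "h \<in> carrier G" for w g h
    using that(1) by (rule WE) (use that(2,3) in \<open>simp add: actW m_assoc\<close>)
  have ex1: "\<exists>!g. g \<in> carrier G \<and> actW w g = w'" if w: "w \<in> W" "w' \<in> W" for w w'
  proof -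
    obtain v g where 1: "v \<in> V" "g \<in> carrier G" "w = \<pi> (v @ g)"
      using w(1) by (rule WE)
    obtain g' where 2: "g' \<in> carrier G" "w' = \<pi> (v @ g')"
      using w(2) 1(1) by (rule W_common)
    \<comment> \<open>Over a common \<open>v\<close>, being moved to \<open>w'\<close> is an
      equation in \<open>G\<close> with exactly one solution.\<close>
    have *: "actW w x = w' \<longleftrightarrow> g \<otimes> x = g'" if "x \<in> carrier G" for x
      using 1 2 that by (simp add: actW pi_eq_same)
    show ?thesis
    proof (rule ex1I[of _ "inv g \<otimes> g'"])
      show "inv g \<otimes> g' \<in> carrier G \<and> actW w (inv g \<otimes> g') = w'"
        using 1 2 *[of "inv g \<otimes> g'"] by (simp add: m_assoc[symmetric])
      fix x assume "x \<in> carrier G \<and> actW w x = w'"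
      then show "x = inv g \<otimes> g'"
        using 1 2 * by (auto simp: m_assoc[symmetric])
    qed
  qed
  have "W \<noteq> {}"
    using nonempty WI[OF _ one_closed] by blast
  then show ?thesis
    unfolding right_torsor_def by (intro conjI ballI actW_closed one assoc ex1)
qed

lemma definable_torsor_W: "definable_torsor M A G W actW"
proof -
  have sub: "pairs \<subseteq> tuples (n + m)"
    by (rule definable_set_subset[OF def_pairs])
  obtain l where l: "definable_set M A l W"
    using definable_image[OF def_pi sub def_pairs order_refl] unfolding W_image by blast
  have gr: "definable_set M A (n + m + l) (graph \<pi> pairs)"
    using definable_map_graph[OF def_pi sub] definable_set_subset[OF l] unfolding W_image by blast
  have mem: "v @ g @ w \<in> graph \<pi> pairs \<longleftrightarrow> w = \<pi> (v @ g)" if "v \<in> V" "g \<in> carrier G" for v g w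
    using append_mem_graph[OF sub, of "v @ g" w \<pi>] that by (simp add: length_V length_G pairsI)
  have "definable_set M A (l + m + l)
      {x @ y @ w | x y w. x \<in> W \<and> y \<in> carrier G \<and> w \<in> W \<and> w = actW x y}"
  proof (rule definable_triples[OF l defG l])
    \<comment> \<open>The action is described through representatives, with \<open>g'\<close>
      standing for the product of \<open>g\<close> and the acting element. The choice of
      representative is immaterial because \<open>actW\<close> is given by the same rule on each of
      them.\<close>
    show "dpred M A (l + m + l) (\<lambda>z. \<exists>v \<in> V. \<exists>g \<in> carrier G. \<exists>g' \<in> carrier G.
        v @ g @ take l z \<in> graph \<pi> pairs \<and> g @ take m (drop l z) @ g' \<in> mult_graph \<and>
        v @ g' @ drop (l + m) z \<in> graph \<pi> pairs)"
      by (intro dpred_ex[OF defV] dpred_ex[OF defG] dpred_mem[OF gr] dpred_mem[OF def_mult_graph] dpred_intros)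
    fix x y w assume "x \<in> W" and y: "y \<in> carrier G" and "w \<in> W"
    obtain v g where 1: "v \<in> V" "g \<in> carrier G" "x = \<pi> (v @ g)"
      using \<open>x \<in> W\<close> by (rule WE)
    show "(\<exists>v \<in> V. \<exists>g \<in> carrier G. \<exists>g' \<in> carrier G.
        v @ g @ x \<in> graph \<pi> pairs \<and> g @ y @ g' \<in> mult_graph \<and> v @ g' @ w \<in> graph \<pi> pairs) \<longleftrightarrow>
      w = actW x y" (is "?L \<longleftrightarrow> ?R")
    proof
      assume ?L
      then obtain v g g' where "v \<in> V" "g \<in> carrier G" "g' \<in> carrier G"
        "v @ g @ x \<in> graph \<pi> pairs" "g @ y @ g' \<in> mult_graph" "v @ g' @ w \<in> graph \<pi> pairs"
        by blast
      then show ?R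
        using y by (simp add: mem mem_mult_graph actW)
    next
      assume ?R
      then show ?L
        using 1 y by (intro bexI[of _ v] bexI[of _ g] bexI[of _ "g \<otimes> y"])
          (simp_all add: mem mem_mult_graph actW)
    qed
  qed
  also have "{x @ y @ w | x y w. x \<in> W \<and> y \<in> carrier G \<and> w \<in> W \<and> w = actW x y} =
      {x @ y @ actW x y | x y. x \<in> W \<and> y \<in> carrier G}"
    using actW_closed by blast
  finally show ?thesis
    using right_torsor_W l definable_set_subset[OF defG] unfolding definable_torsor_def by blast
qed

section \<open>The embedding of the \<open>H\<close>-torsor into the induced torsor\<close>

definition embed where "embed v = \<pi> (v @ \<one>)"

lemma embed_in: "v \<in> V \<Longrightarrow> embed v \<in> W"
  unfolding embed_def by (simp add: WI)

lemma embed_act: "v \<in> V \<Longrightarrow> h \<in> carrier H \<Longrightarrow> embed (act v h) = actW (embed v) h"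
  unfolding embed_def by (simp add: pi_act actW)

lemma embed_inj: "inj_on embed V"
proof (rule inj_onI)
  fix v v' assume 1: "v \<in> V" "v' \<in> V" "embed v = embed v'"
  from 1(3) obtain h where h: "h \<in> carrier H" "v' = act v h" "\<one> = h \<otimes> \<one>"
    unfolding embed_def pi_eq[OF 1(1,2) one_closed one_closed] by blast
  then have "h = \<one>"
    by simp
  then show "v = v'"
    using h(2) 1(1) by (simp add: act_one)
qed

lemma embed_definable: "definable_map M A V embed"
proof -
  have "definable_map M A V (\<lambda>v. v @ \<one>)"
  proof (rule definable_mapI)
    show "V \<subseteq> tuples n"
      by (rule definable_set_subset[OF defV])
    show "(\<lambda>v. v @ \<one>) ` V \<subseteq> tuples (n + m)"
      using length_V length_G[OF one_closed] by (auto simp: tuples_def)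
    \<comment> \<open>The unit is pinned down as the only idempotent of \<open>G\<close>, so that
      the graph of multiplication defines it over \<open>A\<close>.\<close>
    show "dpred M A (n + (n + m)) (\<lambda>z. take n z \<in> V \<and> take n (drop n z) = take n z \<and>
        drop n (drop n z) \<in> carrier G \<and>
        drop n (drop n z) @ drop n (drop n z) @ drop n (drop n z) \<in> mult_graph)"
      by (intro dpred_mem[OF defV] dpred_mem[OF defG] dpred_mem[OF def_mult_graph] dpred_intros)
    fix x y :: "'a list" assume x: "length x = n" "length y = n + m"
    define g where "g = drop n y"
    have "g \<in> carrier G \<and> g @ g @ g \<in> mult_graph \<longleftrightarrow> g = \<one>"
      by (auto simp: mem_mult_graph)
    moreover have "take n y = x \<and> g = \<one> \<longleftrightarrow> y = x @ \<one>"
      using x append_take_drop_id[of n y] by (auto simp: g_def simp del: append_take_drop_id)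
    ultimately show "take n (x @ y) \<in> V \<and> take n (drop n (x @ y)) = take n (x @ y) \<and>
        drop n (drop n (x @ y)) \<in> carrier G \<and>
        drop n (drop n (x @ y)) @ drop n (drop n (x @ y)) @ drop n (drop n (x @ y)) \<in> mult_graph
        \<longleftrightarrow> x \<in> V \<and> y = x @ \<one>"
      using x by (auto simp: g_def[symmetric])
  qed
  then show ?thesis
    unfolding embed_def by (rule definable_map_comp[OF _ def_pi]) (auto intro: pairsI)
qed

lemma embed_image:
  assumes "v \<in> V"
  shows "embed ` V = orbit H actW (embed v)"
proof -
  have V: "V = act v ` carrier H"
    using act_ex1[OF assms] act_closed[OF assms] by blast
  have "embed ` act v ` carrier H = actW (embed v) ` carrier H"
    unfolding image_image by (rule image_cong) (simp_all add: embed_act assms)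
  then show ?thesis
    by (simp add: V[symmetric] orbit_def Setcompr_eq_image)
qed

text \<open>Equivariance of \<open>\<theta>\<close> is exactly what makes the trivialization
  independent of the representative: passing from \<open>(v, h g')\<close> to
  \<open>(v h, g')\<close> does not change the product, as
  \<open>\<theta> (v h) g' = \<theta> v (h g')\<close>. Over a fixed \<open>v\<close> it is left
  multiplication by \<open>\<theta> v\<close>, hence bijective.\<close>

lemma torsor_iso_trivial:
  assumes \<theta>: "definable_map M A V \<theta>" "\<theta> ` V \<subseteq> carrier G"
    and \<theta>_act: "\<And>v h. v \<in> V \<Longrightarrow> h \<in> carrier H \<Longrightarrow> \<theta> (act v h) = \<theta> v \<otimes> h"
  shows "torsor_iso M A G W actW (carrier G) (mult G)"
proof -
  have \<theta>_G: "\<theta> v \<in> carrier G" if "v \<in> V" for v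
    using \<theta>(2) that by blast
  have sub: "pairs \<subseteq> tuples (n + m)"
    by (rule definable_set_subset[OF def_pairs])
  obtain l where l: "definable_set M A l W"
    using definable_image[OF def_pi sub def_pairs order_refl] unfolding W_image by blast
  have gr: "definable_set M A (n + m + l) (graph \<pi> pairs)"
    using definable_map_graph[OF def_pi sub] definable_set_subset[OF l] unfolding W_image by blast
  have mem: "v @ g @ w \<in> graph \<pi> pairs \<longleftrightarrow> w = \<pi> (v @ g)" if "v \<in> V" "g \<in> carrier G" for v g w
    using append_mem_graph[OF sub, of "v @ g" w \<pi>] that by (simp add: length_V length_G pairsI)
  have gr\<theta>: "definable_set M A (n + m) (graph \<theta> V)"
    using definable_map_graph[OF \<theta>(1) definable_set_subset[OF defV]] \<theta>(2)
      definable_set_subset[OF defG] by blast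
  have mem\<theta>: "v @ x \<in> graph \<theta> V \<longleftrightarrow> x = \<theta> v" if "v \<in> V" for v x
    using append_mem_graph[OF definable_set_subset[OF defV], of v x \<theta>] that length_V by simp
  define \<Phi> where "\<Phi> w = (SOME x. \<exists>v \<in> V. \<exists>g \<in> carrier G. w = \<pi> (v @ g) \<and> x = \<theta> v \<otimes> g)" for w
  have \<Phi>: "\<Phi> (\<pi> (v @ g)) = \<theta> v \<otimes> g" if vg: "v \<in> V" "g \<in> carrier G" for v g
    unfolding \<Phi>_def
  proof (rule some_equality)
    show "\<exists>v'\<in>V. \<exists>g'\<in>carrier G. \<pi> (v @ g) = \<pi> (v' @ g') \<and> \<theta> v \<otimes> g = \<theta> v' \<otimes> g'"
      using vg by blast
    fix x assume "\<exists>v'\<in>V. \<exists>g'\<in>carrier G. \<pi> (v @ g) = \<pi> (v' @ g') \<and> x = \<theta> v' \<otimes> g'"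
    then obtain v' g' where 1: "v' \<in> V" "g' \<in> carrier G" "\<pi> (v @ g) = \<pi> (v' @ g')" "x = \<theta> v' \<otimes> g'"
      by blast
    obtain h where "h \<in> carrier H" "v' = act v h" "g = h \<otimes> g'"
      using 1(3) unfolding pi_eq[OF vg(1) 1(1) vg(2) 1(2)] by blast
    then show "x = \<theta> v \<otimes> g"
      using 1 vg \<theta>_G by (simp add: \<theta>_act m_assoc)
  qed
  have "definable_map M A W \<Phi>"
  proof (rule definable_mapI)
    show "W \<subseteq> tuples l"
      by (rule definable_set_subset[OF l])
    have "\<Phi> w \<in> carrier G" if "w \<in> W" for w
      using that by (rule WE) (simp add: \<Phi> \<theta>_G)
    then show "\<Phi> ` W \<subseteq> tuples m"
      using definable_set_subset[OF defG] by blast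
    show "dpred M A (l + m) (\<lambda>z. \<exists>v \<in> V. \<exists>g \<in> carrier G. \<exists>y \<in> carrier G. v @ y \<in> graph \<theta> V \<and>
        v @ g @ take l z \<in> graph \<pi> pairs \<and> y @ g @ drop l z \<in> mult_graph)"
      by (intro dpred_ex[OF defV] dpred_ex[OF defG] dpred_mem[OF gr] dpred_mem[OF gr\<theta>]
          dpred_mem[OF def_mult_graph] dpred_intros)
    fix w x :: "'a list" assume len: "length w = l" "length x = m"
    show "(\<exists>v \<in> V. \<exists>g \<in> carrier G. \<exists>y \<in> carrier G. v @ y \<in> graph \<theta> V \<and>
        v @ g @ take l (w @ x) \<in> graph \<pi> pairs \<and> y @ g @ drop l (w @ x) \<in> mult_graph) \<longleftrightarrow>
      w \<in> W \<and> x = \<Phi> w" (is "?L \<longleftrightarrow> ?R")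
    proof
      assume ?L
      then obtain v g y where "v \<in> V" "g \<in> carrier G" "y \<in> carrier G" "v @ y \<in> graph \<theta> V"
        "v @ g @ w \<in> graph \<pi> pairs" "y @ g @ x \<in> mult_graph"
        using len by auto
      then show ?R
        by (simp add: mem mem\<theta> mem_mult_graph \<Phi> WI)
    next
      assume R: ?R
      then obtain v g where "v \<in> V" "g \<in> carrier G" "w = \<pi> (v @ g)"
        by (auto elim: WE)
      then show ?L
        using R len \<theta>_G by (intro bexI[of _ v] bexI[of _ g] bexI[of _ "\<theta> v"])
          (simp_all add: mem mem\<theta> mem_mult_graph \<Phi>)
    qed
  qed
  moreover have "bij_betw \<Phi> W (carrier G)"
  proof -
    obtain v where v: "v \<in> V"
      using nonempty by blast
    have "inj_on \<Phi> W"
    proof (rule inj_onI)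
      fix w w' assume w: "w \<in> W" "w' \<in> W" "\<Phi> w = \<Phi> w'"
      obtain g where g: "g \<in> carrier G" "w = \<pi> (v @ g)"
        using w(1) v by (rule W_common)
      obtain g' where g': "g' \<in> carrier G" "w' = \<pi> (v @ g')"
        using w(2) v by (rule W_common)
      show "w = w'"
        using w(3) g g' v \<theta>_G[OF v] by (simp add: \<Phi>)
    qed
    moreover have "\<Phi> ` W = carrier G"
    proof (intro subset_antisym subsetI)
      fix x assume "x \<in> \<Phi> ` W"
      then show "x \<in> carrier G"
        using \<Phi> \<theta>_G by (auto elim!: WE)
    next
      fix x assume x: "x \<in> carrier G"
      show "x \<in> \<Phi> ` W"
      proof (rule image_eqI)
        show "\<pi> (v @ (inv (\<theta> v) \<otimes> x)) \<in> W"
          using x v \<theta>_G by (simp add: WI)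
        show "x = \<Phi> (\<pi> (v @ (inv (\<theta> v) \<otimes> x)))"
          using x v \<theta>_G by (simp add: \<Phi> m_assoc[symmetric])
      qed
    qed
    ultimately show ?thesis
      by (simp add: bij_betw_def)
  qed
  moreover have "\<Phi> (actW w g) = \<Phi> w \<otimes> g" if "w \<in> W" "g \<in> carrier G" for w g
    using that(1) by (rule WE) (use that(2) in \<open>simp add: actW \<Phi> \<theta>_G m_assoc\<close>)
  ultimately show ?thesis
    unfolding torsor_iso_def by blast
qed

end

section \<open>The equivalence of torsors\<close>

text \<open>\<open>H\<close> is a record of its own, tied to \<open>G\<close> by its carrier and
  product only. Its unit is idempotent in \<open>G\<close> and therefore the unit of
  \<open>G\<close>.\<close>

lemma definable_subgroup_groupD:
  assumes "definable_subgroup M A H G"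
  shows "group G" "subgroup (carrier H) G" "group H" "\<one>\<^bsub>H\<^esub> = \<one>\<^bsub>G\<^esub>"
    "\<And>x y. x \<in> carrier H \<Longrightarrow> y \<in> carrier H \<Longrightarrow> x \<otimes>\<^bsub>H\<^esub> y = x \<otimes>\<^bsub>G\<^esub> y"
proof -
  show G: "group G" and sub: "subgroup (carrier H) G" and H: "group H"
    and eq: "\<And>x y. x \<in> carrier H \<Longrightarrow> y \<in> carrier H \<Longrightarrow> x \<otimes>\<^bsub>H\<^esub> y = x \<otimes>\<^bsub>G\<^esub> y"
    using assms by (simp_all add: definable_subgroup_def definable_group_def)
  interpret G: group G by (rule G)
  interpret H: group H by (rule H)
  have "\<one>\<^bsub>H\<^esub> \<otimes>\<^bsub>G\<^esub> \<one>\<^bsub>H\<^esub> = \<one>\<^bsub>H\<^esub>"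
    using eq[of "\<one>\<^bsub>H\<^esub>" "\<one>\<^bsub>H\<^esub>"] by simp
  moreover have "\<one>\<^bsub>H\<^esub> \<in> carrier G"
    using subgroup.mem_carrier[OF sub] by simp
  ultimately show "\<one>\<^bsub>H\<^esub> = \<one>\<^bsub>G\<^esub>"
    by simp
qed

lemma subgroup_torsor_exists:
  assumes S: "definable_subgroup M A H G" and T: "definable_torsor M A H V act"
  shows "\<exists>n m. subgroup_torsor G M A H V act n m"
proof -
  note grp = definable_subgroup_groupD[OF S]
  interpret G: group G by (rule grp)
  obtain m where G: "definable_set M A m (carrier G)"
    "definable_set M A (m + m + m) {x @ y @ (x \<otimes>\<^bsub>G\<^esub> y) | x y. x \<in> carrier G \<and> y \<in> carrier G}"
    using S unfolding definable_subgroup_def definable_group_def by blast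
  obtain k where H: "definable_set M A k (carrier H)"
    using S unfolding definable_subgroup_def definable_group_def by blast
  obtain n l where V: "definable_set M A n V" "carrier H \<subseteq> tuples l"
    "definable_set M A (n + l + n) {v @ g @ act v g | v g. v \<in> V \<and> g \<in> carrier H}"
    and R: "right_torsor H V act"
    using T unfolding definable_torsor_def by blast
  have one: "\<one>\<^bsub>G\<^esub> \<in> carrier H"
    using grp(2) by (rule subgroup.one_closed)
  \<comment> \<open>The definitions of \<open>G\<close>, of \<open>H\<close> and of the action come
    with separate arities. They agree because each is the length of the unit, which lies in both
    carriers.\<close>
  have k: "k = m"
    using definable_set_length[OF H one] definable_set_length[OF G(1) G.one_closed] by simp
  have l: "l = m"
    using V(2) one definable_set_length[OF G(1) G.one_closed] by auto
  have "subgroup_torsor G M A H V act n m"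
  proof (rule subgroup_torsor.intro[OF grp(1)], rule subgroup_torsor_axioms.intro)
    show "V \<noteq> {}"
      using R by (simp add: right_torsor_def)
    show "act v h \<in> V" if "v \<in> V" "h \<in> carrier H" for v h
      using R that by (simp add: right_torsor_def)
    show "act v \<one>\<^bsub>G\<^esub> = v" if "v \<in> V" for v
      using R that by (simp add: right_torsor_def grp(4))
    show "act (act v g) h = act v (g \<otimes>\<^bsub>G\<^esub> h)" if "v \<in> V" "g \<in> carrier H" "h \<in> carrier H" for v g h
      using R that by (simp add: right_torsor_def grp(5))
    show "\<exists>!h. h \<in> carrier H \<and> act v h = w" if "v \<in> V" "w \<in> V" for v w
      using R that by (simp add: right_torsor_def)
  qed (use G H V k l grp in simp_all)
  then show ?thesis
    by blast
qed

text \<open>Taking \<open>H = G\<close> makes every \<open>G\<close>-torsor an instance of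
  \<open>subgroup_torsor\<close>; the facts about orbits apply to \<open>W\<close> and to
  \<open>G\<close> itself in this way.\<close>

lemma definable_subgroup_refl: "definable_group M A G \<Longrightarrow> definable_subgroup M A G G"
  by (simp add: definable_subgroup_def definable_group_def group.subgroup_self)

lemma definable_torsor_self:
  assumes "definable_group M A G"
  shows "definable_torsor M A G (carrier G) (mult G)"
proof -
  obtain m where G: "definable_set M A m (carrier G)"
    "definable_set M A (m + m + m) {x @ y @ (x \<otimes>\<^bsub>G\<^esub> y) | x y. x \<in> carrier G \<and> y \<in> carrier G}"
    and grp: "group G"
    using assms unfolding definable_group_def by blast
  interpret group G by (rule grp)
  have "\<exists>!g. g \<in> carrier G \<and> v \<otimes>\<^bsub>G\<^esub> g = w" if "v \<in> carrier G" "w \<in> carrier G" for v w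
  proof (rule ex1I[of _ "inv\<^bsub>G\<^esub> v \<otimes>\<^bsub>G\<^esub> w"])
    show "inv\<^bsub>G\<^esub> v \<otimes>\<^bsub>G\<^esub> w \<in> carrier G \<and> v \<otimes>\<^bsub>G\<^esub> (inv\<^bsub>G\<^esub> v \<otimes>\<^bsub>G\<^esub> w) = w"
      using that by (simp add: m_assoc[symmetric])
    show "g = inv\<^bsub>G\<^esub> v \<otimes>\<^bsub>G\<^esub> w" if "g \<in> carrier G \<and> v \<otimes>\<^bsub>G\<^esub> g = w" for g
      using that \<open>v \<in> carrier G\<close> by (auto simp: m_assoc[symmetric])
  qed
  moreover have "carrier G \<noteq> {}"
    using one_closed by blast
  ultimately have "right_torsor G (carrier G) (mult G)"
    unfolding right_torsor_def by (intro conjI ballI) (simp_all add: m_assoc)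
  then show ?thesis
    using G definable_set_subset[OF G(1)] unfolding definable_torsor_def by blast
qed

lemma definable_map_id:
  assumes "definable_set M A n X"
  shows "definable_map M A X (\<lambda>x. x)"
proof (rule definable_mapI)
  show "X \<subseteq> tuples n" "(\<lambda>x. x) ` X \<subseteq> tuples n"
    using definable_set_subset[OF assms] by simp_all
  show "dpred M A (n + n) (\<lambda>z. take n z \<in> X \<and> drop n z = take n z)"
    by (intro dpred_mem[OF assms] dpred_intros)
qed simp

lemma torsor_iso_refl:
  assumes "definable_torsor M A G V act"
  shows "torsor_iso M A G V act V act"
  using assms definable_map_id unfolding torsor_iso_def definable_torsor_def
  by (intro exI[of _ "\<lambda>x. x"]) (auto simp: bij_betw_def)

lemma torsor_iso_sym:
  assumes iso: "torsor_iso M A G V act V' act'" and V: "right_torsor G V act"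
  shows "torsor_iso M A G V' act' V act"
proof -
  obtain f where f: "definable_map M A V f" "bij_betw f V V'"
    and eq: "\<And>v g. v \<in> V \<Longrightarrow> g \<in> carrier G \<Longrightarrow> f (act v g) = act' (f v) g"
    using iso unfolding torsor_iso_def by blast
  let ?f = "the_inv_into V f"
  have inj: "inj_on f V" and im: "f ` V = V'"
    using f(2) by (simp_all add: bij_betw_def)
  have "?f (act' w g) = act (?f w) g" if "w \<in> V'" "g \<in> carrier G" for w g
  proof -
    have w: "?f w \<in> V" "f (?f w) = w"
      using the_inv_into_into[OF inj, of w V] f_the_inv_into_f[OF inj, of w] im that by simp_all
    have "act (?f w) g \<in> V"
      using V w(1) that(2) by (simp add: right_torsor_def)
    moreover have "f (act (?f w) g) = act' w g"
      using eq[OF w(1) that(2)] w(2) by simp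
    ultimately show ?thesis
      using the_inv_into_f_eq[OF inj] by blast
  qed
  moreover have "bij_betw ?f V' V"
    using f(2) by (rule bij_betw_the_inv_into)
  ultimately show ?thesis
    using definable_map_inv[OF f] unfolding torsor_iso_def by blast
qed

lemma torsor_iso_trans:
  assumes "torsor_iso M A G V act V' act'" and "torsor_iso M A G V' act' V'' act''"
  shows "torsor_iso M A G V act V'' act''"
proof -
  obtain f where f: "definable_map M A V f" "bij_betw f V V'"
    "\<forall>v \<in> V. \<forall>g \<in> carrier G. f (act v g) = act' (f v) g"
    using assms(1) unfolding torsor_iso_def by blast
  obtain f' where f': "definable_map M A V' f'" "bij_betw f' V' V''"
    "\<forall>v \<in> V'. \<forall>g \<in> carrier G. f' (act' v g) = act'' (f' v) g"
    using assms(2) unfolding torsor_iso_def by blast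
  have im: "f ` V = V'"
    using f(2) by (rule bij_betw_imp_surj_on)
  show ?thesis
    unfolding torsor_iso_def
  proof (intro exI[of _ "\<lambda>v. f' (f v)"] conjI ballI)
    show "definable_map M A V (\<lambda>v. f' (f v))"
      using definable_map_comp[OF f(1) f'(1)] im by simp
    show "bij_betw (\<lambda>v. f' (f v)) V V''"
      using bij_betw_trans[OF f(2) f'(2)] by (simp add: comp_def)
    fix v g assume "v \<in> V" "g \<in> carrier G"
    then show "f' (f (act v g)) = act'' (f' (f v)) g"
      using f(3) f'(3) im by auto
  qed
qed

lemma torsor_rel_iff:
  "((V, act), (V', act')) \<in> torsor_rel M A G \<longleftrightarrow>
    definable_torsor M A G V act \<and> definable_torsor M A G V' act' \<and> torsor_iso M A G V act V' act'"
  by (simp add: torsor_rel_def)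

lemma equiv_torsor_rel: "equiv (torsors M A G) (torsor_rel M A G)"
proof (rule equivI)
  show "torsor_rel M A G \<subseteq> torsors M A G \<times> torsors M A G"
    by (auto simp: torsor_rel_def torsors_def)
  show "refl_on (torsors M A G) (torsor_rel M A G)"
    by (auto simp: refl_on_def torsor_rel_def torsors_def torsor_iso_refl)
  show "sym_on UNIV (torsor_rel M A G)"
  proof (rule symI)
    fix p q assume "(p, q) \<in> torsor_rel M A G"
    then show "(q, p) \<in> torsor_rel M A G"
      using torsor_iso_sym by (cases p, cases q) (auto simp: torsor_rel_iff definable_torsor_def)
  qed
  show "trans_on UNIV (torsor_rel M A G)"
  proof (rule transI)
    fix p q r assume "(p, q) \<in> torsor_rel M A G" "(q, r) \<in> torsor_rel M A G"
    then show "(p, r) \<in> torsor_rel M A G"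
      using torsor_iso_trans by (cases p, cases q, cases r) (simp add: torsor_rel_iff, blast)
  qed
qed

section \<open>Orbits of a subgroup and existence of induced torsors\<close>

context subgroup_torsor
begin

text \<open>Here \<open>K\<close> is a subgroup of the group \<open>H\<close> for which
  \<open>V\<close> is a torsor. In the applications the roles are shifted: \<open>G\<close> acts
  simply transitively and the orbits are those of \<open>H\<close>.\<close>

lemma orbit_eq_iff:
  assumes K: "subgroup (carrier K) G" "carrier K \<subseteq> carrier H" and xy: "x \<in> V" "y \<in> V"
  shows "orbit K act x = orbit K act y \<longleftrightarrow> (\<exists>k \<in> carrier K. y = act x k)"
proof
  assume eq: "orbit K act x = orbit K act y"
  have "y \<in> orbit K act y"
    unfolding orbit_def using subgroup.one_closed[OF K(1)] act_one[OF xy(2)] by force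
  then have "y \<in> orbit K act x"
    unfolding eq .
  then show "\<exists>k \<in> carrier K. y = act x k"
    unfolding orbit_def by blast
next
  assume "\<exists>k \<in> carrier K. y = act x k"
  then obtain k where k: "k \<in> carrier K" "y = act x k"
    by blast
  have KH: "h \<in> carrier K \<Longrightarrow> h \<in> carrier H" for h
    using K(2) by blast
  have 1: "act y h = act x (k \<otimes> h)" if "h \<in> carrier K" for h
    using k that KH xy(1) by (simp add: act_act)
  have 2: "act x h = act y (inv k \<otimes> h)" if "h \<in> carrier K" for h
    using k that KH xy(1) subgroup.m_inv_closed[OF K(1)]
    by (simp add: act_act m_assoc[symmetric])
  have closed: "k \<otimes> h \<in> carrier K" "inv k \<otimes> h \<in> carrier K" if "h \<in> carrier K" for h
    using k(1) that subgroup.m_closed[OF K(1)] subgroup.m_inv_closed[OF K(1)] by simp_all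
  show "orbit K act x = orbit K act y"
  proof (intro subset_antisym subsetI)
    fix w assume "w \<in> orbit K act x"
    then show "w \<in> orbit K act y"
      unfolding orbit_def using 2 closed(2) by blast
  next
    fix w assume "w \<in> orbit K act y"
    then show "w \<in> orbit K act x"
      unfolding orbit_def using 1 closed(1) by blast
  qed
qed

lemma orbit_quotient:
  assumes "eliminates_imaginaries M" and K: "subgroup (carrier K) G" "carrier K \<subseteq> carrier H"
    and defK: "definable_set M A m (carrier K)"
  shows "\<exists>\<pi>. quotient_map M A V (\<lambda>x y. orbit K act x = orbit K act y) \<pi>"
proof (rule quotient_map_exists[OF assms(1) defV])
  show "definable_set M A (n + n) {x @ y | x y. x \<in> V \<and> y \<in> V \<and> orbit K act x = orbit K act y}"
  proof (rule definable_pairs[OF defV defV])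
    show "dpred M A (n + n) (\<lambda>z. \<exists>k \<in> carrier K. take n z @ k @ drop n z \<in> act_graph)"
      by (intro dpred_ex[OF defK] dpred_mem[OF def_act_graph] dpred_intros)
    fix x y assume xy: "x \<in> V" "y \<in> V"
    have "x @ k @ y \<in> act_graph \<longleftrightarrow> y = act x k" if "k \<in> carrier K" for k
      using mem_act_graph[OF xy(1)] K(2) that by blast
    then show "(\<exists>k \<in> carrier K. x @ k @ y \<in> act_graph) \<longleftrightarrow> orbit K act x = orbit K act y"
      unfolding orbit_eq_iff[OF K xy] by blast
  qed
qed simp_all

text \<open>A quotient map collapses the orbit of \<open>w\<close> to the single value
  \<open>\<pi> w\<close>. If the orbit is definable over \<open>A\<close>, so is its image, and a
  definable singleton lies in \<open>dcl M A\<close>. The point \<open>w\<close> itself need not be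
  defined over \<open>A\<close>.\<close>

lemma orbit_point:
  assumes \<pi>: "quotient_map M A V (\<lambda>x y. orbit K act x = orbit K act y) \<pi>"
    and K: "subgroup (carrier K) G" "carrier K \<subseteq> carrier H"
    and w: "w \<in> V" and def_orbit: "definable_set M A l (orbit K act w)"
  shows "set (\<pi> w) \<subseteq> dcl M A"
proof -
  have w_orbit: "w \<in> orbit K act w"
    unfolding orbit_def using subgroup.one_closed[OF K(1)] act_one[OF w] by force
  have sub: "orbit K act w \<subseteq> V"
    unfolding orbit_def using act_closed[OF w] K(2) by blast
  have "l = n"
    using definable_set_length[OF def_orbit w_orbit] length_V[OF w] by simp
  then have def_orbit: "definable_set M A n (orbit K act w)"
    using def_orbit by simp
  have "\<pi> x = \<pi> w" if "x \<in> orbit K act w" for x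
  proof -
    have "x \<in> V" "\<exists>k \<in> carrier K. x = act w k"
      using that sub by (auto simp: orbit_def)
    then have "orbit K act w = orbit K act x"
      using orbit_eq_iff[OF K w] by blast
    then show ?thesis
      using \<pi> w \<open>x \<in> V\<close> by (simp add: quotient_map_def)
  qed
  then have im: "\<pi> ` orbit K act w = {\<pi> w}"
    using w_orbit by blast
  have "definable_map M A V \<pi>"
    using \<pi> by (simp add: quotient_map_def)
  from definable_image[OF this definable_set_subset[OF defV] def_orbit sub]
  obtain j where j: "definable_set M A j {\<pi> w}"
    unfolding im by blast
  then have "j = length (\<pi> w)"
    using definable_set_length[OF j] by simp
  with j show ?thesis
    by (simp add: definable_singleton_iff[symmetric])
qed

lemma induced_torsor_iff:
  "induced_torsor M A H G V act W actW \<longleftrightarrow> (\<exists>\<pi>. induced G M A H V act n m \<pi> W actW)"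
proof -
  have "induced G M A H V act n m \<pi> W actW \<longleftrightarrow> quotient_map M A pairs rel \<pi> \<and>
      W = {\<pi> (v @ g) | v g. v \<in> V \<and> g \<in> carrier G} \<and>
      (\<forall>v \<in> V. \<forall>g \<in> carrier G. \<forall>g' \<in> carrier G. actW (\<pi> (v @ g)) g' = \<pi> (v @ (g \<otimes> g')))" for \<pi>
    unfolding induced_def induced_axioms_def using subgroup_torsor_axioms by blast
  moreover have "rel = (\<lambda>x y. \<exists>v1 \<in> V. \<exists>g1 \<in> carrier G. \<exists>v2 \<in> V. \<exists>g2 \<in> carrier G. x = v1 @ g1 \<and> y = v2 @ g2 \<and>
    (\<exists>h \<in> carrier H. v2 = act v1 h \<and> g1 = h \<otimes> g2))"
    by (intro ext) (rule rel_def)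
  ultimately show ?thesis
    unfolding induced_torsor_def pairs_def by simp
qed

text \<open>The action is well defined because the relation changes the second coordinate on the
  left and the action changes it on the right: from \<open>g = h g'\<close> follows
  \<open>g x = h (g' x)\<close> with the same \<open>h\<close>.\<close>

lemma induced_exists:
  assumes "eliminates_imaginaries M"
  shows "\<exists>\<pi> W actW. induced G M A H V act n m \<pi> W actW"
proof -
  obtain \<pi> where \<pi>: "quotient_map M A pairs rel \<pi>"
    using quotient_exists[OF assms] by blast
  define actW where "actW w g' =
    (SOME x. \<exists>v \<in> V. \<exists>g \<in> carrier G. w = \<pi> (v @ g) \<and> x = \<pi> (v @ (g \<otimes> g')))" for w g'
  have pi_eq: "\<pi> (v @ g) = \<pi> (v' @ g') \<longleftrightarrow> (\<exists>h \<in> carrier H. v' = act v h \<and> g = h \<otimes> g')"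
    if "v \<in> V" "v' \<in> V" "g \<in> carrier G" "g' \<in> carrier G" for v v' g g'
    using \<pi> that by (simp add: quotient_map_def pairsI rel_append)
  have "actW (\<pi> (v @ g)) x = \<pi> (v @ (g \<otimes> x))" if 1: "v \<in> V" "g \<in> carrier G" "x \<in> carrier G" for v g x
    unfolding actW_def
  proof (rule some_equality)
    show "\<exists>v'\<in>V. \<exists>g'\<in>carrier G. \<pi> (v @ g) = \<pi> (v' @ g') \<and> \<pi> (v @ (g \<otimes> x)) = \<pi> (v' @ (g' \<otimes> x))"
      using 1 by blast
    fix y assume "\<exists>v'\<in>V. \<exists>g'\<in>carrier G. \<pi> (v @ g) = \<pi> (v' @ g') \<and> y = \<pi> (v' @ (g' \<otimes> x))"
    then obtain v' g' where 2: "v' \<in> V" "g' \<in> carrier G" "\<pi> (v @ g) = \<pi> (v' @ g')" "y = \<pi> (v' @ (g' \<otimes> x))"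
      by blast
    obtain h where "h \<in> carrier H" "v' = act v h" "g = h \<otimes> g'"
      using 2(3) unfolding pi_eq[OF 1(1) 2(1) 1(2) 2(2)] by blast
    then have "\<pi> (v @ (g \<otimes> x)) = \<pi> (v' @ (g' \<otimes> x))"
      using 1 2 by (subst pi_eq) (auto simp: m_assoc)
    then show "y = \<pi> (v @ (g \<otimes> x))"
      using 2(4) by simp
  qed
  then have "induced G M A H V act n m \<pi> {\<pi> (v @ g) | v g. v \<in> V \<and> g \<in> carrier G} actW"
    by (intro induced.intro subgroup_torsor_axioms induced_axioms.intro \<pi> refl)
  then show ?thesis
    by blast
qed

end

section \<open>Trivial classes, primitives and Galois extensions\<close>

text \<open>The middle term in the criterion for triviality: it arises by restricting a
  trivialization of the induced torsor, its image is a coset, and its value at \<open>b\<close> is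
  the primitive.\<close>

definition torsor_embedding where
  "torsor_embedding M A G H V act \<theta> \<longleftrightarrow> definable_map M A V \<theta> \<and> inj_on \<theta> V \<and> \<theta> ` V \<subseteq> carrier G \<and>
    (\<forall>v \<in> V. \<forall>h \<in> carrier H. \<theta> (act v h) = \<theta> v \<otimes>\<^bsub>G\<^esub> h)"

text \<open>Needed because a class contains all torsors isomorphic to \<open>V\<close>, so that an
  embedding has to be passed between \<open>V\<close> and the other members.\<close>

lemma torsor_embedding_comp:
  assumes f: "torsor_iso M A H V act V' act'" and \<theta>: "torsor_embedding M A G H V' act' \<theta>"
  shows "\<exists>\<theta>. torsor_embedding M A G H V act \<theta>"
proof -
  obtain f where f: "definable_map M A V f" "bij_betw f V V'"
    "\<And>v g. v \<in> V \<Longrightarrow> g \<in> carrier H \<Longrightarrow> f (act v g) = act' (f v) g"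
    using f unfolding torsor_iso_def by blast
  have im: "f ` V = V'" and inj: "inj_on f V"
    using f(2) by (simp_all add: bij_betw_def)
  have fV: "f v \<in> V'" if "v \<in> V" for v
    using im that by blast
  have "torsor_embedding M A G H V act (\<lambda>v. \<theta> (f v))"
    unfolding torsor_embedding_def
  proof (intro conjI ballI)
    have "definable_map M A V' \<theta>"
      using \<theta> unfolding torsor_embedding_def by blast
    from definable_map_comp[OF f(1) this] show "definable_map M A V (\<lambda>v. \<theta> (f v))"
      by (simp add: im)
    have "inj_on \<theta> (f ` V)"
      using \<theta> im unfolding torsor_embedding_def by simp
    from comp_inj_on[OF inj this] show "inj_on (\<lambda>v. \<theta> (f v)) V"
      by (simp add: comp_def)
    show "(\<lambda>v. \<theta> (f v)) ` V \<subseteq> carrier G"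
      using \<theta> fV unfolding torsor_embedding_def by blast
    show "\<theta> (f (act v h)) = \<theta> (f v) \<otimes>\<^bsub>G\<^esub> h" if "v \<in> V" "h \<in> carrier H" for v h
      using \<theta> f(3)[OF that] fV[OF that(1)] that(2) unfolding torsor_embedding_def by simp
  qed
  then show ?thesis
    by blast
qed

lemma (in induced) torsor_embedding_exists:
  assumes "torsor_iso M A G W actW (carrier G) (mult G)"
  shows "\<exists>\<theta>. torsor_embedding M A G H V act \<theta>"
proof -
  obtain f where f: "definable_map M A W f" "bij_betw f W (carrier G)"
    "\<And>v g. v \<in> W \<Longrightarrow> g \<in> carrier G \<Longrightarrow> f (actW v g) = f v \<otimes> g"
    using assms unfolding torsor_iso_def by blast
  have im: "f ` W = carrier G" and inj: "inj_on f W"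
    using f(2) by (simp_all add: bij_betw_def)
  have emb: "embed ` V \<subseteq> W"
    using embed_in by blast
  have "torsor_embedding M A G H V act (\<lambda>v. f (embed v))"
    unfolding torsor_embedding_def
  proof (intro conjI ballI)
    show "definable_map M A V (\<lambda>v. f (embed v))"
      by (rule definable_map_comp[OF embed_definable f(1) emb])
    show "inj_on (\<lambda>v. f (embed v)) V"
      using comp_inj_on[OF embed_inj inj_on_subset[OF inj emb]] by (simp add: comp_def)
    show "(\<lambda>v. f (embed v)) ` V \<subseteq> carrier G"
      using im embed_in by blast
    show "f (embed (act v h)) = f (embed v) \<otimes> h" if "v \<in> V" "h \<in> carrier H" for v h
      using that f(3) embed_in embed_act by simp
  qed
  then show ?thesis
    by blast
qed

text \<open>\<open>V\<close> is a single orbit, so an equivariant map sends it onto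
  \<open>\<theta> v H\<close> for any \<open>v\<close>. The representative \<open>\<theta> v\<close>
  need not be an \<open>A\<close>-point; the coset is definable over \<open>A\<close> as the image
  of \<open>V\<close>.\<close>

lemma torsor_embedding_iff_coset:
  assumes S: "definable_subgroup M A H G" and T: "definable_torsor M A H V act"
  shows "(\<exists>\<theta>. torsor_embedding M A G H V act \<theta>) \<longleftrightarrow>
    (\<exists>g \<in> carrier G. (\<exists>n. definable_set M A n (g <#\<^bsub>G\<^esub> carrier H)) \<and>
      torsor_iso M A H V act (g <#\<^bsub>G\<^esub> carrier H) (mult G))"
proof -
  obtain n m where "subgroup_torsor G M A H V act n m"
    using subgroup_torsor_exists[OF S T] by blast
  then interpret subgroup_torsor G M A H V act n m .
  show ?thesis
  proof
    assume "\<exists>\<theta>. torsor_embedding M A G H V act \<theta>"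
    then obtain \<theta> where "torsor_embedding M A G H V act \<theta>"
      by blast
    then have \<theta>: "definable_map M A V \<theta>" "inj_on \<theta> V" "\<theta> ` V \<subseteq> carrier G"
      "\<forall>v \<in> V. \<forall>h \<in> carrier H. \<theta> (act v h) = \<theta> v \<otimes>\<^bsub>G\<^esub> h"
      by (simp_all add: torsor_embedding_def)
    obtain v where v: "v \<in> V"
      using nonempty by blast
    have V: "V = act v ` carrier H"
      using act_ex1[OF v] act_closed[OF v] by blast
    have "\<theta> ` V = (\<lambda>h. \<theta> v \<otimes>\<^bsub>G\<^esub> h) ` carrier H"
      unfolding V image_image by (rule image_cong) (simp_all add: \<theta>(4) v)
    also have "\<dots> = \<theta> v <#\<^bsub>G\<^esub> carrier H"
      by (auto simp: l_coset_def)
    finally have im: "\<theta> ` V = \<theta> v <#\<^bsub>G\<^esub> carrier H" .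
    have "\<exists>n. definable_set M A n (\<theta> v <#\<^bsub>G\<^esub> carrier H)"
      using definable_image[OF \<theta>(1) definable_set_subset[OF defV] defV order_refl] unfolding im .
    moreover have "torsor_iso M A H V act (\<theta> v <#\<^bsub>G\<^esub> carrier H) (mult G)"
      unfolding torsor_iso_def bij_betw_def using \<theta>(1,2,4) im by (intro exI[of _ \<theta>]) simp
    moreover have "\<theta> v \<in> carrier G"
      using \<theta>(3) v by blast
    ultimately show "\<exists>g \<in> carrier G. (\<exists>n. definable_set M A n (g <#\<^bsub>G\<^esub> carrier H)) \<and>
        torsor_iso M A H V act (g <#\<^bsub>G\<^esub> carrier H) (mult G)"
      by blast
  next
    assume "\<exists>g \<in> carrier G. (\<exists>n. definable_set M A n (g <#\<^bsub>G\<^esub> carrier H)) \<and>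
        torsor_iso M A H V act (g <#\<^bsub>G\<^esub> carrier H) (mult G)"
    then obtain g where g: "g \<in> carrier G"
      and "torsor_iso M A H V act (g <#\<^bsub>G\<^esub> carrier H) (mult G)"
      by blast
    then obtain \<theta> where \<theta>: "definable_map M A V \<theta>"
      "bij_betw \<theta> V (g <#\<^bsub>G\<^esub> carrier H)" "\<forall>v \<in> V. \<forall>h \<in> carrier H. \<theta> (act v h) = \<theta> v \<otimes>\<^bsub>G\<^esub> h"
      unfolding torsor_iso_def by blast
    have "g <#\<^bsub>G\<^esub> carrier H \<subseteq> carrier G"
      using g by (intro l_coset_subset_G) auto
    then have "torsor_embedding M A G H V act \<theta>"
      using \<theta> by (simp add: torsor_embedding_def bij_betw_def)
    then show "\<exists>\<theta>. torsor_embedding M A G H V act \<theta>"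
      by blast
  qed
qed

context
  fixes M :: "('f, 'r, 'a) struct" and A :: "'a set" and H G :: "'a list monoid"
    and V :: "'a list set" and act :: "'a list \<Rightarrow> 'a list \<Rightarrow> 'a list"
  assumes EI: "eliminates_imaginaries M"
    and S: "definable_subgroup M A H G" and T: "definable_torsor M A H V act"
begin

lemma self_torsor_class: "((V, act), (V, act)) \<in> torsor_rel M A H"
  by (simp add: torsor_rel_iff T torsor_iso_refl[OF T])

lemma self_trivial_class: "((carrier G, mult G), (carrier G, mult G)) \<in> torsor_rel M A G"
  using S by (simp add: torsor_rel_iff definable_torsor_self torsor_iso_refl definable_subgroup_def)

text \<open>Equality of classes is used through one member: \<open>G\<close> lies in the trivial
  class, so some torsor induced by some \<open>V'\<close> in the class of \<open>V\<close> is
  isomorphic to \<open>G\<close>. The embedding found for \<open>V'\<close> is then pulled back to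
  \<open>V\<close>.\<close>

lemma embedding_of_iota1_trivial:
  assumes "iota1 M A H G (torsor_class M A H V act) = trivial_class M A G"
  shows "\<exists>\<theta>. torsor_embedding M A G H V act \<theta>"
proof -
  have "(carrier G, mult G) \<in> trivial_class M A G"
    by (simp add: trivial_class_def torsor_class_def self_trivial_class)
  then have "(carrier G, mult G) \<in> iota1 M A H G (torsor_class M A H V act)"
    unfolding assms .
  then obtain W actW V' act' where 1: "((W, actW), (carrier G, mult G)) \<in> torsor_rel M A G"
    "(V', act') \<in> torsor_class M A H V act" "induced_torsor M A H G V' act' W actW"
    unfolding iota1_def by blast
  have 2: "definable_torsor M A H V' act'" "torsor_iso M A H V act V' act'"
    using 1(2) by (simp_all add: torsor_class_def torsor_rel_iff)
  obtain n m where nm: "subgroup_torsor G M A H V' act' n m"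
    using subgroup_torsor_exists[OF S 2(1)] by blast
  then obtain \<pi> where "induced G M A H V' act' n m \<pi> W actW"
    using subgroup_torsor.induced_torsor_iff[OF nm] 1(3) by blast
  then obtain \<theta> where "torsor_embedding M A G H V' act' \<theta>"
    using induced.torsor_embedding_exists 1(1) by (metis torsor_rel_iff)
  with 2(2) show ?thesis
    by (rule torsor_embedding_comp)
qed

lemma iota1_trivial_of_embedding:
  assumes "torsor_embedding M A G H V act \<theta>"
  shows "iota1 M A H G (torsor_class M A H V act) = trivial_class M A G"
proof -
  let ?S = "{(W, actW). \<exists>(V, act) \<in> torsor_class M A H V act. induced_torsor M A H G V act W actW}"
  \<comment> \<open>Every torsor that \<open>iota1\<close> collects is trivial, whichever member of
    the class and whichever quotient map it comes from.\<close>
  have S_rel: "(p, (carrier G, mult G)) \<in> torsor_rel M A G" if "p \<in> ?S" for p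
  proof -
    obtain W actW V' act' where 1: "p = (W, actW)"
      "(V', act') \<in> torsor_class M A H V act" "induced_torsor M A H G V' act' W actW"
      using \<open>p \<in> ?S\<close> by blast
    have 2: "definable_torsor M A H V' act'" "torsor_iso M A H V act V' act'"
      using 1(2) by (simp_all add: torsor_class_def torsor_rel_iff)
    have "torsor_iso M A H V' act' V act"
      using torsor_iso_sym[OF 2(2)] T by (simp add: definable_torsor_def)
    then obtain \<theta>' where \<theta>': "torsor_embedding M A G H V' act' \<theta>'"
      using torsor_embedding_comp assms by blast
    obtain n m where nm: "subgroup_torsor G M A H V' act' n m"
      using subgroup_torsor_exists[OF S 2(1)] by blast
    then obtain \<pi> where "induced G M A H V' act' n m \<pi> W actW"
      using subgroup_torsor.induced_torsor_iff[OF nm] 1(3) by blast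
    then interpret induced G M A H V' act' n m \<pi> W actW .
    have "torsor_iso M A G W actW (carrier G) (mult G)"
      using \<theta>' unfolding torsor_embedding_def by (intro torsor_iso_trivial[of \<theta>']) simp_all
    then show ?thesis
      using definable_torsor_W self_trivial_class by (simp add: 1(1) torsor_rel_iff)
  qed
  \<comment> \<open>The collection must also be nonempty, as otherwise its image under the relation
    would be empty instead of the trivial class. Elimination of imaginaries provides a
    member.\<close>
  obtain n m where nm: "subgroup_torsor G M A H V act n m"
    using subgroup_torsor_exists[OF S T] by blast
  obtain \<pi> W actW where "induced G M A H V act n m \<pi> W actW"
    using subgroup_torsor.induced_exists[OF nm EI] by blast
  then have "induced_torsor M A H G V act W actW"
    using subgroup_torsor.induced_torsor_iff[OF nm] by blast
  then have W: "(W, actW) \<in> ?S"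
    using self_torsor_class unfolding torsor_class_def by blast
  have sym: "(q, p) \<in> torsor_rel M A G" if "(p, q) \<in> torsor_rel M A G" for p q
    using equiv_torsor_rel that by (meson equiv_def symE)
  have trans: "(p, r) \<in> torsor_rel M A G"
    if "(p, q) \<in> torsor_rel M A G" "(q, r) \<in> torsor_rel M A G" for p q r
    using equiv_torsor_rel that by (meson equiv_def transE)
  have "torsor_rel M A G `` ?S = torsor_rel M A G `` {(carrier G, mult G)}"
  proof (intro subset_antisym subsetI)
    fix q assume "q \<in> torsor_rel M A G `` ?S"
    then obtain p where "p \<in> ?S" "(p, q) \<in> torsor_rel M A G"
      by (rule ImageE)
    then have "((carrier G, mult G), q) \<in> torsor_rel M A G"
      using trans[OF sym[OF S_rel]] by simp
    then show "q \<in> torsor_rel M A G `` {(carrier G, mult G)}"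
      by simp
  next
    fix q assume "q \<in> torsor_rel M A G `` {(carrier G, mult G)}"
    then have "((carrier G, mult G), q) \<in> torsor_rel M A G"
      by simp
    then have "((W, actW), q) \<in> torsor_rel M A G"
      by (rule trans[OF S_rel[OF W]])
    then show "q \<in> torsor_rel M A G `` ?S"
      using W by (rule ImageI)
  qed
  then show ?thesis
    unfolding iota1_def trivial_class_def torsor_class_def .
qed

lemma iota1_trivial_iff:
  "iota1 M A H G (torsor_class M A H V act) = trivial_class M A G \<longleftrightarrow>
    (\<exists>\<theta>. torsor_embedding M A G H V act \<theta>)"
  using embedding_of_iota1_trivial iota1_trivial_of_embedding by blast

lemma iota1_trivial_of_H1_trivial:
  assumes "H1_def M A G = {trivial_class M A G}"
  shows "iota1 M A H G (torsor_class M A H V act) = trivial_class M A G"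
proof -
  obtain n m where nm: "subgroup_torsor G M A H V act n m"
    using subgroup_torsor_exists[OF S T] by blast
  obtain \<pi> W actW where ind: "induced G M A H V act n m \<pi> W actW"
    using subgroup_torsor.induced_exists[OF nm EI] by blast
  then interpret induced G M A H V act n m \<pi> W actW .
  \<comment> \<open>One induced torsor suffices: its class is among those of \<open>G\<close>, hence
    the trivial one, and a trivialization yields an embedding of \<open>V\<close>.\<close>
  have "torsor_class M A G W actW \<in> H1_def M A G"
    unfolding H1_def_def torsor_class_def torsors_def
    using definable_torsor_W by (intro quotientI) simp
  then have "(carrier G, mult G) \<in> torsor_class M A G W actW"
    using self_trivial_class unfolding assms trivial_class_def torsor_class_def by simp
  then have "torsor_iso M A G W actW (carrier G) (mult G)"
    by (simp add: torsor_class_def torsor_rel_iff)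
  then show ?thesis
    unfolding iota1_trivial_iff by (rule torsor_embedding_exists)
qed

lemma GH_primitive_generator:
  assumes \<theta>: "torsor_embedding M A G H V act \<theta>" and b: "b \<in> V" and A: "dcl M A = A"
  shows "\<exists>c. GH_primitive M A G H c \<and> dcl M (A \<union> set b) = dcl M (A \<union> set c)"
proof -
  have \<theta>: "definable_map M A V \<theta>" "inj_on \<theta> V" "\<theta> ` V \<subseteq> carrier G"
    "\<And>v h. v \<in> V \<Longrightarrow> h \<in> carrier H \<Longrightarrow> \<theta> (act v h) = \<theta> v \<otimes>\<^bsub>G\<^esub> h"
    using \<theta> unfolding torsor_embedding_def by blast+
  obtain n m where "subgroup_torsor G M A H V act n m"
    using subgroup_torsor_exists[OF S T] by blast
  then interpret V: subgroup_torsor G M A H V act n m .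
  have G: "definable_group M A G"
    using S by (simp add: definable_subgroup_def)
  \<comment> \<open>\<open>G\<close> acting on itself by right multiplication: the orbits of
    \<open>H\<close> are the left cosets, so the quotient by orbits is \<open>G/H\<close>.\<close>
  obtain n' m' where "subgroup_torsor G M A G (carrier G) (mult G) n' m'"
    using subgroup_torsor_exists[OF definable_subgroup_refl[OF G] definable_torsor_self[OF G]] by blast
  then interpret W: subgroup_torsor G M A G "carrier G" "mult G" n' m' .
  have m: "m' = m"
    using W.length_G[OF V.one_closed] V.length_G[OF V.one_closed] by simp
  have HG: "carrier H \<subseteq> carrier G"
    using V.sub by (rule subgroup.subset)
  have orbit: "orbit H (mult G) x = x <#\<^bsub>G\<^esub> carrier H" for x
    by (auto simp: orbit_def l_coset_def)
  obtain \<pi> where \<pi>: "quotient_map M A (carrier G) (\<lambda>x y. orbit H (mult G) x = orbit H (mult G) y) \<pi>"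
    using W.orbit_quotient[OF EI V.sub HG] V.defH m by blast
  have b': "\<theta> b \<in> carrier G"
    using \<theta>(3) b by blast
  have V_eq: "V = act b ` carrier H"
    using V.act_ex1[OF b] V.act_closed[OF b] by blast
  have "\<theta> ` V = (\<lambda>h. \<theta> b \<otimes>\<^bsub>G\<^esub> h) ` carrier H"
    unfolding V_eq image_image by (rule image_cong) (simp_all add: \<theta>(4)[OF b])
  also have "\<dots> = orbit H (mult G) (\<theta> b)"
    by (auto simp: orbit_def)
  finally have im: "\<theta> ` V = orbit H (mult G) (\<theta> b)" .
  obtain l where "definable_set M A l (orbit H (mult G) (\<theta> b))"
    using definable_image[OF \<theta>(1) definable_set_subset[OF V.defV] V.defV order_refl]
    unfolding im by blast
  then have "set (\<pi> (\<theta> b)) \<subseteq> A"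
    using W.orbit_point[OF \<pi> V.sub HG b'] A by simp
  then have "GH_primitive M A G H (\<theta> b)"
    using \<pi> b' unfolding GH_primitive_def points_def orbit by blast
  moreover have "dcl M (A \<union> set b) = dcl M (A \<union> set (\<theta> b))"
    by (rule dcl_definable_inj[OF \<theta>(1,2) b, symmetric])
  ultimately show ?thesis
    by blast
qed

lemma WGH_primitive_generator:
  assumes b: "b \<in> V" and A: "dcl M A = A"
  shows "\<exists>W actW. definable_torsor M A G W actW \<and>
    (\<exists>w \<in> W. torsor_iso M A H V act (orbit H actW w) actW) \<and>
    (\<exists>c. WGH_primitive M A H W actW c \<and> dcl M (A \<union> set b) = dcl M (A \<union> set c))"
proof -
  obtain n m where nm: "subgroup_torsor G M A H V act n m"
    using subgroup_torsor_exists[OF S T] by blast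
  obtain \<pi> W actW where ind: "induced G M A H V act n m \<pi> W actW"
    using subgroup_torsor.induced_exists[OF nm EI] by blast
  then interpret V: induced G M A H V act n m \<pi> W actW .
  let ?f = V.embed
  have G: "definable_group M A G"
    using S by (simp add: definable_subgroup_def)
  \<comment> \<open>A second view of the same data, with \<open>W\<close> as a torsor for the full
    group \<open>G\<close>, in which the orbits of \<open>H\<close> on \<open>W\<close> can be
    formed.\<close>
  obtain n' m' where "subgroup_torsor G M A G W actW n' m'"
    using subgroup_torsor_exists[OF definable_subgroup_refl[OF G] V.definable_torsor_W] by blast
  then interpret W: subgroup_torsor G M A G W actW n' m' .
  have m: "m' = m"
    using W.length_G[OF V.one_closed] V.length_G[OF V.one_closed] by simp
  have HG: "carrier H \<subseteq> carrier G"
    using V.sub by (rule subgroup.subset)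
  obtain \<rho> where \<rho>: "quotient_map M A W (\<lambda>x y. orbit H actW x = orbit H actW y) \<rho>"
    using W.orbit_quotient[OF EI V.sub HG] V.defH m by blast
  have fb: "?f b \<in> W"
    by (rule V.embed_in[OF b])
  obtain l where "definable_set M A l (orbit H actW (?f b))"
    using definable_image[OF V.embed_definable definable_set_subset[OF V.defV] V.defV order_refl]
    unfolding V.embed_image[OF b] by blast
  then have "set (\<rho> (?f b)) \<subseteq> A"
    using W.orbit_point[OF \<rho> V.sub HG fb] A by simp
  then have "WGH_primitive M A H W actW (?f b)"
    using \<rho> fb unfolding WGH_primitive_def points_def by blast
  moreover have "dcl M (A \<union> set b) = dcl M (A \<union> set (?f b))"
    by (rule dcl_definable_inj[OF V.embed_definable V.embed_inj b, symmetric])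
  moreover have "torsor_iso M A H V act (orbit H actW (?f b)) actW"
    unfolding torsor_iso_def
  proof (intro exI[of _ ?f] conjI ballI)
    show "bij_betw ?f V (orbit H actW (?f b))"
      unfolding bij_betw_def using V.embed_inj V.embed_image[OF b] by blast
  qed (simp_all add: V.embed_definable V.embed_act)
  ultimately show ?thesis
    using V.definable_torsor_W fb by blast
qed

end

section \<open>Properties depending only on the type of \<open>b\<close>\<close>

lemma realization_iff:
  assumes Z: "definable_set M A (length b) Z" and c: "c \<in> realizations M (length b) (tp M A b)"
  shows "c \<in> Z \<longleftrightarrow> b \<in> Z"
proof -
  have *: "c \<in> Z" if Z: "definable_set M A (length b) Z" "b \<in> Z" for Z
  proof -
    obtain p where p: "p \<in> param_formulas M A (length b)" "Z = {x \<in> tuples (length b). holds M x p}"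
      using Z(1) unfolding definable_set_def by blast
    then have "p \<in> tp M A b"
      using Z(2) by (simp add: tp_def)
    then show "c \<in> Z"
      using c p(2) by (simp add: realizations_def)
  qed
  have len: "length c = length b"
    using c by (simp add: realizations_def tuples_def)
  \<comment> \<open>A type decides every formula over \<open>A\<close>; applying the first
    implication to the complement of \<open>Z\<close> gives the converse.\<close>
  have "definable_set M A (length b) {z \<in> tuples (length b). z \<notin> Z}"
    using dpred_not[OF dpred_mem[OF Z tuple_term_id]] by (simp add: dpred_def)
  from *[OF this] *[OF Z] show ?thesis
    by (auto simp: tuples_def)
qed

lemma self_realization: "b \<in> realizations M (length b) (tp M A b)"
  by (simp add: realizations_def tp_def tuples_def)

text \<open>A point \<open>x\<close> of \<open>X\<close> defined over \<open>A\<close> and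
  \<open>c\<close> is transferred to \<open>b\<close>: the same formula read at \<open>b\<close>
  defines a point \<open>u\<close> of \<open>X\<close> in \<open>dcl M (A \<union> set b)\<close>,
  hence an \<open>A\<close>-point. That \<open>u\<close> satisfies the formula is now a statement
  over \<open>A\<close>, so it passes back to \<open>c\<close> and forces
  \<open>u = x\<close>.\<close>

lemma weakly_orthogonal_iff:
  assumes X: "definable_set M A k X" and A: "dcl M A = A"
  shows "weakly_orthogonal M A X (length b) (tp M A b) \<longleftrightarrow> points X (dcl M (A \<union> set b)) = points X A"
proof
  assume eq: "points X (dcl M (A \<union> set b)) = points X A"
  show "weakly_orthogonal M A X (length b) (tp M A b)"
    unfolding weakly_orthogonal_def
  proof (intro ballI subset_antisym subsetI)
    fix c x assume c: "c \<in> realizations M (length b) (tp M A b)"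
      and x: "x \<in> points X (dcl M (A \<union> set c))"
    have lc: "length c = length b"
      using c by (simp add: realizations_def tuples_def)
    have xX: "x \<in> X"
      using x by (simp add: points_def)
    have lx: "length x = k"
      using definable_set_length[OF X xX] .
    have "definable_set M (A \<union> set c) k {x}"
      using x definable_singleton_iff[of M "A \<union> set c" x] lx by (simp add: points_def)
    then obtain Y where Y: "definable_set M A (k + length b) Y"
      "\<forall>u. u \<in> {x} \<longleftrightarrow> length u = k \<and> u @ c \<in> Y"
      unfolding lc[symmetric] by (rule definable_over_tuple)
    \<comment> \<open>The condition that the fibre of \<open>Y\<close> over \<open>z\<close> is a
      single tuple and that this tuple lies in \<open>X\<close>. It is expressed over
      \<open>A\<close> and holds at \<open>c\<close>.\<close>
    define Z where "Z = {z \<in> tuples (length b). (\<exists>u \<in> X. u @ z \<in> Y) \<and>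
      (\<forall>u \<in> tuples k. \<forall>v \<in> tuples k. u @ z \<in> Y \<longrightarrow> v @ z \<in> Y \<longrightarrow> u = v)}"
    have "dpred M A (length b) (\<lambda>z. (\<exists>u \<in> X. u @ z \<in> Y) \<and>
      (\<forall>u \<in> tuples k. \<forall>v \<in> tuples k. u @ z \<in> Y \<longrightarrow> v @ z \<in> Y \<longrightarrow> u = v))"
      by (intro dpred_conj dpred_ex[OF X] dpred_all[OF definable_tuples] dpred_mem[OF Y(1)] dpred_intros)
    then have Z: "definable_set M A (length b) Z"
      unfolding Z_def dpred_def .
    have "c \<in> Z"
      unfolding Z_def
    proof (intro CollectI conjI ballI impI)
      show "c \<in> tuples (length b)"
        using lc by (simp add: tuples_def)
      show "\<exists>u \<in> X. u @ c \<in> Y"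
        using xX Y(2) by blast
      fix u v assume "u \<in> tuples k" "v \<in> tuples k" "u @ c \<in> Y" "v @ c \<in> Y"
      then have "u \<in> {x}" "v \<in> {x}"
        using Y(2) by (simp_all add: tuples_def)
      then show "u = v"
        by simp
    qed
    then have "b \<in> Z"
      using realization_iff[OF Z c] by simp
    then obtain u where u: "u \<in> X" "u @ b \<in> Y" and
      uniq: "\<forall>u \<in> tuples k. \<forall>v \<in> tuples k. u @ b \<in> Y \<longrightarrow> v @ b \<in> Y \<longrightarrow> u = v"
      unfolding Z_def by blast
    have lu: "length u = k"
      using definable_set_length[OF X u(1)] .
    have "dpred M (A \<union> set b) k (\<lambda>v. v @ b \<in> Y)"
      by (intro dpred_mem[OF definable_set_mono[OF Y(1)]] dpred_intros tuple_term_const) auto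
    moreover have "{v \<in> tuples k. v @ b \<in> Y} = {u}"
      using u(2) lu uniq by (auto simp: tuples_def)
    ultimately have "definable_set M (A \<union> set b) (length u) {u}"
      by (simp add: dpred_def lu)
    then have "u \<in> points X (dcl M (A \<union> set b))"
      using u(1) by (simp add: definable_singleton_iff points_def)
    then have uA: "u \<in> points X A"
      using eq by simp
    \<comment> \<open>With the entries of \<open>u\<close> in \<open>A\<close>, they may serve as
      parameters of a formula in \<open>z\<close> alone.\<close>
    have "dpred M A (length b) (\<lambda>z. u @ z \<in> Y)"
      using uA by (intro dpred_mem[OF Y(1)] dpred_intros tuple_term_const) (simp add: points_def)
    then have "c \<in> {z \<in> tuples (length b). u @ z \<in> Y} \<longleftrightarrow> b \<in> {z \<in> tuples (length b). u @ z \<in> Y}"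
      using c by (intro realization_iff) (simp_all add: dpred_def)
    then have "u @ c \<in> Y"
      using u(2) lc by (simp add: tuples_def)
    then have "u \<in> {x}"
      using Y(2) lu by blast
    then show "x \<in> points X A"
      using uA by simp
  next
    fix c x assume "x \<in> points X A"
    then show "x \<in> points X (dcl M (A \<union> set c))"
      using dcl_mono[of A "A \<union> set c" M] A unfolding points_def by blast
  qed
qed (use self_realization in \<open>auto simp: weakly_orthogonal_def\<close>)

lemma strongly_internal_torsor:
  assumes H: "definable_group M A H" and Q: "definable_torsor M A H Q act" and b: "b \<in> Q"
  shows "strongly_internal M A (carrier H) (length b) (tp M A b)"
  unfolding strongly_internal_def
proof (intro ballI)
  obtain n m where "subgroup_torsor H M A H Q act n m"
    using subgroup_torsor_exists[OF definable_subgroup_refl[OF H] Q] by blast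
  then interpret subgroup_torsor H M A H Q act n m .
  fix b1 b2 assume b12: "b1 \<in> realizations M (length b) (tp M A b)"
    "b2 \<in> realizations M (length b) (tp M A b)"
  have "definable_set M A (length b) Q"
    using defV length_V[OF b] by simp
  then have b12: "b1 \<in> Q" "b2 \<in> Q"
    using realization_iff b12 b by blast+
  obtain h where h: "h \<in> carrier H" "b2 = act b1 h"
    using act_ex1[OF b12] by blast
  let ?C = "set b1 \<union> A \<union> coords (carrier H)"
  have "set h \<subseteq> ?C"
    using h(1) by (auto simp: coords_def)
  then have "dpred M ?C n (\<lambda>w. b1 @ h @ w \<in> act_graph)"
    by (intro dpred_mem[OF definable_set_mono[OF def_act_graph]] dpred_intros tuple_term_const) auto
  moreover have "{w \<in> tuples n. b1 @ h @ w \<in> act_graph} = {b2}"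
    using mem_act_graph[OF b12(1) h(1)] h(2) length_V[OF b12(2)] by (auto simp: tuples_def)
  ultimately show "set b2 \<subseteq> dcl M ?C"
    using length_V[OF b12(2)] by (simp add: dpred_def definable_singleton_iff[symmetric])
qed

text \<open>A Galois extension may be witnessed by any generating tuple, not only by
  \<open>b\<close>. For every generator, weak orthogonality is the same condition on the points of
  \<open>H\<close> in \<open>B\<close>, which gives one direction at once; for the other,
  \<open>b\<close> itself is the witness, being strongly internal.\<close>

lemma galois_extension_torsor_iff:
  assumes H: "definable_group M A H" and Q: "definable_torsor M A H Q act" and b: "b \<in> Q"
    and A: "dcl M A = A"
  shows "galois_extension M A (carrier H) (dcl M (A \<union> set b)) \<longleftrightarrow>
    points (carrier H) (dcl M (A \<union> set b)) = points (carrier H) A"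
proof -
  obtain k where k: "definable_set M A k (carrier H)"
    using H unfolding definable_group_def by blast
  show ?thesis
    using strongly_internal_torsor[OF H Q b]
    unfolding galois_extension_def strong_weak_type_def weakly_orthogonal_iff[OF k A] by metis
qed

theorem theorem2p8:
  fixes M :: "('f, 'r, 'a) struct" and T :: "('f, 'r) fm set" and \<kappa> :: "'k rel" and A :: "'a set"
  assumes "complete_theory M T"
    and "monster_model M T \<kappa>"
    and "totally_transcendental M"
    and "eliminates_imaginaries M"
    and "|A| <o \<kappa>"
    and "dcl M A = A"
  shows "(\<forall>H Q act b.
      definable_group M A H \<and> definable_torsor M A H Q act \<and> b \<in> Q \<longrightarrow>
        (galois_extension M A (carrier H) (dcl M (A \<union> set b)) \<longleftrightarrow>
         points (carrier H) (dcl M (A \<union> set b)) = points (carrier H) A))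
    \<and>
    (\<forall>X k b B Q H act G.
      definable_set M A k X \<and> strong_weak_type M A X b \<and> B = dcl M (A \<union> set b) \<and>
      Q = realizations M (length b) (tp M A b) \<and>
      torsor_theorem_group M A X Q H act \<and>
      definable_subgroup M A H G \<longrightarrow>
        (\<exists>W actW. definable_torsor M A G W actW \<and>
          (\<exists>w \<in> W. torsor_iso M A H Q act (orbit H actW w) actW) \<and>
          (\<exists>c. WGH_primitive M A H W actW c \<and> B = dcl M (A \<union> set c)))
        \<and>
        (iota1 M A H G (torsor_class M A H Q act) = trivial_class M A G \<longleftrightarrow>
          (\<exists>g \<in> carrier G. (\<exists>n. definable_set M A n (g <#\<^bsub>G\<^esub> carrier H)) \<and>
            torsor_iso M A H Q act (g <#\<^bsub>G\<^esub> carrier H) (mult G)))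
        \<and>
        (iota1 M A H G (torsor_class M A H Q act) = trivial_class M A G \<longrightarrow>
          (\<exists>c. GH_primitive M A G H c \<and> B = dcl M (A \<union> set c)))
        \<and>
        (H1_def M A G = {trivial_class M A G} \<longrightarrow>
          iota1 M A H G (torsor_class M A H Q act) = trivial_class M A G))"
proof (rule conjI; (intro allI impI; elim conjE)?)
  fix H Q act b
  assume "definable_group M A H" "definable_torsor M A H Q act" "b \<in> Q"
  then show "galois_extension M A (carrier H) (dcl M (A \<union> set b)) \<longleftrightarrow>
      points (carrier H) (dcl M (A \<union> set b)) = points (carrier H) A"
    using assms(6) by (rule galois_extension_torsor_iff)
next
  fix X k b B Q H act G
  assume B: "B = dcl M (A \<union> set b)" and Q: "Q = realizations M (length b) (tp M A b)"
    and "torsor_theorem_group M A X Q H act" and S: "definable_subgroup M A H G"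
  then have T: "definable_torsor M A H Q act"
    by (simp add: torsor_theorem_group_def)
  have b: "b \<in> Q"
    unfolding Q by (rule self_realization)
  note iff = iota1_trivial_iff[OF assms(4) S T]
  show "(\<exists>W actW. definable_torsor M A G W actW \<and>
          (\<exists>w \<in> W. torsor_iso M A H Q act (orbit H actW w) actW) \<and>
          (\<exists>c. WGH_primitive M A H W actW c \<and> B = dcl M (A \<union> set c)))
        \<and>
        (iota1 M A H G (torsor_class M A H Q act) = trivial_class M A G \<longleftrightarrow>
          (\<exists>g \<in> carrier G. (\<exists>n. definable_set M A n (g <#\<^bsub>G\<^esub> carrier H)) \<and>
            torsor_iso M A H Q act (g <#\<^bsub>G\<^esub> carrier H) (mult G)))
        \<and>
        (iota1 M A H G (torsor_class M A H Q act) = trivial_class M A G \<longrightarrow>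
          (\<exists>c. GH_primitive M A G H c \<and> B = dcl M (A \<union> set c)))
        \<and>
        (H1_def M A G = {trivial_class M A G} \<longrightarrow>
          iota1 M A H G (torsor_class M A H Q act) = trivial_class M A G)"
  proof (intro conjI impI)
    show "\<exists>W actW. definable_torsor M A G W actW \<and>
          (\<exists>w \<in> W. torsor_iso M A H Q act (orbit H actW w) actW) \<and>
          (\<exists>c. WGH_primitive M A H W actW c \<and> B = dcl M (A \<union> set c))"
      unfolding B by (rule WGH_primitive_generator[OF assms(4) S T b assms(6)])
    show "iota1 M A H G (torsor_class M A H Q act) = trivial_class M A G \<longleftrightarrow>
          (\<exists>g \<in> carrier G. (\<exists>n. definable_set M A n (g <#\<^bsub>G\<^esub> carrier H)) \<and>
            torsor_iso M A H Q act (g <#\<^bsub>G\<^esub> carrier H) (mult G))"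
      unfolding iff by (rule torsor_embedding_iff_coset[OF S T])
    show "\<exists>c. GH_primitive M A G H c \<and> B = dcl M (A \<union> set c)"
      if "iota1 M A H G (torsor_class M A H Q act) = trivial_class M A G"
      using that GH_primitive_generator[OF assms(4) S T _ b assms(6)] unfolding B iff by blast
    show "iota1 M A H G (torsor_class M A H Q act) = trivial_class M A G"
      if "H1_def M A G = {trivial_class M A G}"
      by (rule iota1_trivial_of_H1_trivial[OF assms(4) S T that])
  qed
qed

end
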